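(* Let $(M,J)$ be a compact, connected, almost complex manifold of (real) dimension $2n$ with second Betti number $b_2$ and first Chern class $c_1$. Let $\tilde{\mathcal L}$ be a full rank sublattice of $\mathcal L=H^2(M;\mathbb Z)/\operatorname{Tor}(H^2(M;\mathbb Z))$ and let $\{\eta_1,\ldots,\eta_{b_2}\}$ be a $\mathbb Z$-basis of $\tilde{\mathcal L}$ such that $c_1\in\tilde{\mathcal L}$ and $$c_1=\sum_{i=1}^{b_2}m_i\eta_i$$ for some positive integers $m_i\in\mathbb Z_{>0}$. Let $\widetilde H\colon\mathcal L\to\mathbb Z$ be the index map and assume that $\widetilde H(-c_1)\neq 0$ and $$\widetilde H(-k_1\eta_1-\cdots-k_{b_2}\eta_{b_2})=0$$ for all $k_1,\ldots,k_{b_2}\in\mathbb Z$ such that $0<k_i\le m_i$ for all $i=1,\ldots,b_2$ and $\sum_{i=1}^{b_2}k_i<\sum_{i=1}^{b_2}m_i$. Let $\mathrm H\in\mathbb Q[z_1,\ldots,z_{b_2}]$ be the generalized Hilbert polynomial. Then $$n\ \ge\ \deg(\mathrm H)\ \ge\ \sum_{i=1}^{b_2}(m_i-1).$$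
   Context: For a compact, connected almost complex manifold $(M,J)$ of real dimension $2n$, $c_1$ denotes the first Chern class of $(TM,J)$, regarded in $\mathcal L$. The index map $\widetilde H$ sends $\eta\in H^2(M;\mathbb Z)$ to the Atiyah-Singer index $\operatorname{Ind}(e^{2\pi\mathrm i\eta})$ of the complex line bundle $e^{2\pi\mathrm i\eta}$ with first Chern class $\eta$; by the index formula $\widetilde H(\eta)=\big(\sum_{l\ge 0}\eta^l/l!\big)\,\mathcal T[M]$, where $\mathcal T$ is the total Todd class of $(M,J)$. It depends only on the class of $\eta$ modulo torsion, hence induces a map $\widetilde H\colon\mathcal L\to\mathbb Z$. Fixing a $\mathbb Z$-basis $\tau_1,\ldots,\tau_{b_2}$ of $\mathcal L$, the generalized Hilbert polynomial $\mathrm H\in\mathbb Q[z_1,\ldots,z_{b_2}]$ is the unique polynomial with $\mathrm H(k_1,\ldots,k_{b_2})=\widetilde H(k_1\tau_1+\cdots+k_{b_2}\tau_{b_2})$ for all $(k_1,\ldots,k_{b_2})\in\mathbb Z^{b_2}$. *)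

theory Defs
  imports
    "HOL-Analysis.Analysis"
    "HOL-Homology.Homology"
    "HOL-Algebra.QuotRing"
    "HOL-Computational_Algebra.Formal_Power_Series"
begin

section \<open>Singular cohomology rings\<close>

text \<open>
  Cochains of all degrees are treated together: \<open>f p \<sigma>\<close> is the value of the degree \<open>p\<close> component of
  \<open>f\<close> on the singular \<open>p\<close>-simplex \<open>\<sigma>\<close>, and it is normalised to be \<open>0\<close> if \<open>\<sigma>\<close> is not such a
  simplex. The cohomology ring is thus the product of the groups \<open>H\<^sup>p(X;R)\<close> over all \<open>p\<close>; for a compact
  manifold this is the usual direct sum. The coefficient ring \<open>R\<close> is a type.
\<close>

type_synonym ('a, 'r) cochain = "nat \<Rightarrow> ((nat \<Rightarrow> real) \<Rightarrow> 'a) \<Rightarrow> 'r"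

type_synonym ('a, 'r) cohom = "('a, 'r) cochain set"

definition cochains :: "'a topology \<Rightarrow> ('a, 'r::comm_ring_1) cochain set" where
  "cochains X = {f. \<forall>p \<sigma>. \<not> singular_simplex p X \<sigma> \<longrightarrow> f p \<sigma> = 0}"

definition coboundary :: "'a topology \<Rightarrow> ('a, 'r::comm_ring_1) cochain \<Rightarrow> ('a, 'r) cochain" where
  "coboundary X f = (\<lambda>p \<sigma>. if 0 < p \<and> singular_simplex p X \<sigma>
     then \<Sum>i\<le>p. (-1) ^ i * f (p - 1) (singular_face p i \<sigma>) else 0)"

definition cocycles :: "'a topology \<Rightarrow> ('a, 'r::comm_ring_1) cochain set" where
  "cocycles X = {f \<in> cochains X. coboundary X f = (\<lambda>p \<sigma>. 0)}"

definition coboundaries :: "'a topology \<Rightarrow> ('a, 'r::comm_ring_1) cochain set" where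
  "coboundaries X = coboundary X ` cochains X"

definition front_face :: "nat \<Rightarrow> ((nat \<Rightarrow> real) \<Rightarrow> 'a) \<Rightarrow> (nat \<Rightarrow> real) \<Rightarrow> 'a" where
  "front_face p \<sigma> = restrict \<sigma> (standard_simplex p)"

definition back_face :: "nat \<Rightarrow> nat \<Rightarrow> ((nat \<Rightarrow> real) \<Rightarrow> 'a) \<Rightarrow> (nat \<Rightarrow> real) \<Rightarrow> 'a" where
  "back_face p q \<sigma> = restrict (\<lambda>x. \<sigma> (\<lambda>i. if i < p then 0 else x (i - p))) (standard_simplex q)"

definition const_cochain :: "'a topology \<Rightarrow> 'r::comm_ring_1 \<Rightarrow> ('a, 'r) cochain" where
  "const_cochain X r = (\<lambda>p \<sigma>. if p = 0 \<and> singular_simplex p X \<sigma> then r else 0)"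

definition cup :: "'a topology \<Rightarrow> ('a, 'r::comm_ring_1) cochain \<Rightarrow> ('a, 'r) cochain \<Rightarrow> ('a, 'r) cochain"
  where
  "cup X f g = (\<lambda>p \<sigma>. if singular_simplex p X \<sigma>
     then \<Sum>i\<le>p. f i (front_face i \<sigma>) * g (p - i) (back_face i (p - i) \<sigma>) else 0)"

definition cocycle_ring :: "'a topology \<Rightarrow> ('a, 'r::comm_ring_1) cochain ring" where
  "cocycle_ring X = \<lparr>carrier = cocycles X, monoid.mult = cup X, one = const_cochain X 1,
     zero = (\<lambda>p \<sigma>. 0), add = (\<lambda>f g p \<sigma>. f p \<sigma> + g p \<sigma>)\<rparr>"

definition cohomology_ring :: "'a topology \<Rightarrow> ('a, 'r::comm_ring_1) cohom ring" where
  "cohomology_ring X = cocycle_ring X Quot coboundaries X"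

definition cohom_class :: "'a topology \<Rightarrow> ('a, 'r::comm_ring_1) cochain \<Rightarrow> ('a, 'r) cohom" where
  "cohom_class X f = coboundaries X +>\<^bsub>cocycle_ring X\<^esub> f"

definition cohomology :: "nat \<Rightarrow> 'a topology \<Rightarrow> ('a, 'r::comm_ring_1) cohom set" where
  "cohomology p X = cohom_class X ` {f \<in> cocycles X. \<forall>q. q \<noteq> p \<longrightarrow> f q = (\<lambda>\<sigma>. 0)}"

definition rep :: "'b set \<Rightarrow> 'b" where
  "rep x = (SOME f. f \<in> x)"

definition cochain_pullback ::
  "'b topology \<Rightarrow> ('b \<Rightarrow> 'a) \<Rightarrow> ('a, 'r::comm_ring_1) cochain \<Rightarrow> ('b, 'r) cochain" where
  "cochain_pullback Y g f =
     (\<lambda>p \<sigma>. if singular_simplex p Y \<sigma> then f p (simplex_map p g \<sigma>) else 0)"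

definition cohom_pullback ::
  "'b topology \<Rightarrow> ('b \<Rightarrow> 'a) \<Rightarrow> ('a, 'r::comm_ring_1) cohom \<Rightarrow> ('b, 'r) cohom" where
  "cohom_pullback Y g x = cohom_class Y (cochain_pullback Y g (rep x))"

definition rationalize :: "'a topology \<Rightarrow> ('a, int) cohom \<Rightarrow> ('a, rat) cohom" where
  "rationalize X x = cohom_class X (\<lambda>p \<sigma>. of_int (rep x p \<sigma>))"

text \<open>
  The formal sum of classes \<open>x l\<close> of degree \<open>2 l\<close>, \<open>l \<ge> 0\<close>: its component of degree \<open>2 l\<close> is that
  of \<open>x l\<close>.
\<close>
definition even_series :: "'a topology \<Rightarrow> (nat \<Rightarrow> ('a, 'r::comm_ring_1) cohom) \<Rightarrow> ('a, 'r) cohom" where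
  "even_series X x = cohom_class X (\<lambda>p \<sigma>. if even p then rep (x (p div 2)) p \<sigma> else 0)"

definition cohom_exp :: "'a topology \<Rightarrow> ('a, rat) cohom \<Rightarrow> ('a, rat) cohom" where
  "cohom_exp X y = even_series X (\<lambda>l. cohom_class X (const_cochain X (1 / fact l))
     \<otimes>\<^bsub>cohomology_ring X\<^esub> (y [^]\<^bsub>cohomology_ring X\<^esub> l))"

text \<open>Evaluation of the degree \<open>p\<close> component of a cohomology class on a homology class.\<close>
definition kronecker :: "nat \<Rightarrow> ('a, rat) cohom \<Rightarrow> 'a chain set \<Rightarrow> rat" where
  "kronecker p x \<mu> = (\<Sum>\<sigma>\<in>Poly_Mapping.keys (rep \<mu>).
     of_int (Poly_Mapping.lookup (rep \<mu>) \<sigma>) * rep x p \<sigma>)"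


section \<open>Finitely generated abelian groups and lattices\<close>

definition ab_rank :: "'g monoid \<Rightarrow> nat" where
  "ab_rank G = Sup {card S | S. finite S \<and> S \<subseteq> carrier G \<and>
     (\<forall>k :: 'g \<Rightarrow> int. finprod G (\<lambda>s. s [^]\<^bsub>G\<^esub> k s) S = \<one>\<^bsub>G\<^esub> \<longrightarrow> (\<forall>s\<in>S. k s = 0))}"

definition betti_number :: "nat \<Rightarrow> 'a topology \<Rightarrow> nat" where
  "betti_number p X = ab_rank (homology_group (int p) X)"

text \<open>The groups here are written multiplicatively: this is \<open>k\<^sub>1 e\<^sub>1 + \<dots> + k\<^sub>b e\<^sub>b\<close>.\<close>
definition int_comb :: "'g monoid \<Rightarrow> nat \<Rightarrow> (nat \<Rightarrow> 'g) \<Rightarrow> (nat \<Rightarrow> int) \<Rightarrow> 'g" where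
  "int_comb G b e k = finprod G (\<lambda>i. e i [^]\<^bsub>G\<^esub> k i) {1..b}"

definition Z_basis :: "'g monoid \<Rightarrow> nat \<Rightarrow> (nat \<Rightarrow> 'g) \<Rightarrow> bool" where
  "Z_basis G b e \<longleftrightarrow> (\<forall>i\<in>{1..b}. e i \<in> carrier G) \<and>
     (\<forall>x\<in>carrier G. \<exists>k. x = int_comb G b e k) \<and>
     (\<forall>k. int_comb G b e k = \<one>\<^bsub>G\<^esub> \<longrightarrow> (\<forall>i\<in>{1..b}. k i = 0))"

definition full_rank_sublattice :: "'g set \<Rightarrow> 'g monoid \<Rightarrow> bool" where
  "full_rank_sublattice L' L \<longleftrightarrow> subgroup L' L \<and> ab_rank (L\<lparr>carrier := L'\<rparr>) = ab_rank L"

definition cohom2_group :: "'a topology \<Rightarrow> ('a, int) cohom monoid" where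
  "cohom2_group X = \<lparr>carrier = cohomology 2 X, monoid.mult = add (cohomology_ring X),
     one = zero (cohomology_ring X)\<rparr>"

definition torsion :: "'g monoid \<Rightarrow> 'g set" where
  "torsion G = {x \<in> carrier G. \<exists>k::nat. 0 < k \<and> x [^]\<^bsub>G\<^esub> k = \<one>\<^bsub>G\<^esub>}"

text \<open>\<open>H\<^sup>2(X;\<int>)\<close> modulo torsion.\<close>
definition cohom2_lattice :: "'a topology \<Rightarrow> ('a, int) cohom set monoid" where
  "cohom2_lattice X = cohom2_group X Mod torsion (cohom2_group X)"


section \<open>Chern classes of complex vector bundles\<close>

text \<open>
  Only the part of the structure of a complex vector bundle that the definition of its Chern classes
  refers to is recorded.
\<close>
record ('b, 'e) complex_bundle =
  Base :: "'b topology"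
  Total :: "'e topology"
  Proj :: "'e \<Rightarrow> 'b"
  Zero :: "'b \<Rightarrow> 'e"
  Scale :: "complex \<Rightarrow> 'e \<Rightarrow> 'e"

definition nonzero_vectors :: "('b, 'e) complex_bundle \<Rightarrow> 'e topology" where
  "nonzero_vectors E = subtopology (Total E) (topspace (Total E) - Zero E ` topspace (Base E))"

text \<open>
  The vertices \<open>-1 - \<i>\<close>, \<open>1\<close>, \<open>\<i>\<close> span a triangle in the complex plane that contains \<open>0\<close> and is
  positively oriented. Its image in the complex line of a nonzero vector \<open>v\<close> is the generator of
  \<open>H\<^sub>2(\<complex>v, \<complex>v - 0)\<close> given by the complex orientation.
\<close>
definition fibre_triangle :: "('b, 'e) complex_bundle \<Rightarrow> 'e \<Rightarrow> (nat \<Rightarrow> real) \<Rightarrow> 'e" where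
  "fibre_triangle E v = restrict (\<lambda>x. Scale E
     (complex_of_real (x 0) * (-1 - \<i>) + complex_of_real (x 1) + complex_of_real (x 2) * \<i>) v)
     (standard_simplex 2)"

definition thom_cocycle :: "('b, 'e) complex_bundle \<Rightarrow> ('e, int) cochain \<Rightarrow> bool" where
  "thom_cocycle K u \<longleftrightarrow> u \<in> cocycles (Total K) \<and> (\<forall>q. q \<noteq> 2 \<longrightarrow> u q = (\<lambda>\<sigma>. 0)) \<and>
     (\<forall>\<sigma>. singular_simplex 2 (nonzero_vectors K) \<sigma> \<longrightarrow> u 2 \<sigma> = 0) \<and>
     (\<forall>v\<in>topspace (nonzero_vectors K). u 2 (fibre_triangle K v) = 1)"

text \<open>The first Chern class of a line bundle is its Euler class: the zero section pulls back the Thom class.\<close>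
definition line_bundle_c1 :: "('b, 'e) complex_bundle \<Rightarrow> ('b, int) cohom" where
  "line_bundle_c1 K = (THE x. \<exists>u. thom_cocycle K u \<and>
     x = cohom_class (Base K) (cochain_pullback (Base K) (Zero K) u))"

definition final_topology :: "'x topology \<Rightarrow> ('x \<Rightarrow> 'y) \<Rightarrow> 'y topology" where
  "final_topology X f =
     topology (\<lambda>W. W \<subseteq> f ` topspace X \<and> openin X {x \<in> topspace X. f x \<in> W})"

lemma openin_final_topology:
  "openin (final_topology X f) W \<longleftrightarrow>
     W \<subseteq> f ` topspace X \<and> openin X {x \<in> topspace X. f x \<in> W}"
proof -
  have "istopology (\<lambda>W. W \<subseteq> f ` topspace X \<and> openin X {x \<in> topspace X. f x \<in> W})"
    unfolding istopology_def
  proof (intro conjI allI impI)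
    fix S T
    assume "S \<subseteq> f ` topspace X \<and> openin X {x \<in> topspace X. f x \<in> S}"
      and "T \<subseteq> f ` topspace X \<and> openin X {x \<in> topspace X. f x \<in> T}"
    then have "openin X ({x \<in> topspace X. f x \<in> S} \<inter> {x \<in> topspace X. f x \<in> T})"
      by blast
    moreover have "{x \<in> topspace X. f x \<in> S} \<inter> {x \<in> topspace X. f x \<in> T}
        = {x \<in> topspace X. f x \<in> S \<inter> T}"
      by auto
    ultimately show "openin X {x \<in> topspace X. f x \<in> S \<inter> T}"
      by simp
  next
    fix \<K>
    assume *: "\<forall>K\<in>\<K>. K \<subseteq> f ` topspace X \<and> openin X {x \<in> topspace X. f x \<in> K}"
    have "openin X (\<Union>K\<in>\<K>. {x \<in> topspace X. f x \<in> K})"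
      using * by blast
    moreover have "(\<Union>K\<in>\<K>. {x \<in> topspace X. f x \<in> K}) = {x \<in> topspace X. f x \<in> \<Union>\<K>}"
      by auto
    ultimately show "openin X {x \<in> topspace X. f x \<in> \<Union>\<K>}"
      by simp
  qed auto
  then show ?thesis
    unfolding final_topology_def by simp
qed

definition complex_line :: "('b, 'e) complex_bundle \<Rightarrow> 'e \<Rightarrow> 'e set" where
  "complex_line E v = range (\<lambda>z. Scale E z v)"

definition projectivization :: "('b, 'e) complex_bundle \<Rightarrow> 'e set topology" where
  "projectivization E = final_topology (nonzero_vectors E) (complex_line E)"

definition line_foot :: "('b, 'e) complex_bundle \<Rightarrow> 'e set \<Rightarrow> 'b" where
  "line_foot E l = Proj E (rep l)"

definition tautological_bundle :: "('b, 'e) complex_bundle \<Rightarrow> ('e set, 'e set \<times> 'e) complex_bundle" where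
  "tautological_bundle E = \<lparr>
     Base = projectivization E,
     Total = subtopology (prod_topology (projectivization E) (Total E)) {(l, v). v \<in> l},
     Proj = fst,
     Zero = (\<lambda>l. (l, Zero E (line_foot E l))),
     Scale = (\<lambda>z (l, v). (l, Scale E z v))\<rparr>"

text \<open>
  Grothendieck's relation: for a bundle \<open>E\<close> of rank \<open>n\<close> with projectivization \<open>\<pi> : P(E) \<rightarrow> X\<close> (the
  space of lines), and with \<open>\<xi>\<close> the first Chern class of the dual of the tautological line bundle,
  \<open>\<pi>\<^sup>*c\<^sub>0 \<xi>\<^sup>n + \<pi>\<^sup>*c\<^sub>1 \<xi>\<^sup>n\<^sup>-\<^sup>1 + \<dots> + \<pi>\<^sup>*c\<^sub>n = 0\<close>.
\<close>
definition is_chern_classes ::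
  "nat \<Rightarrow> ('b, 'e) complex_bundle \<Rightarrow> (nat \<Rightarrow> ('b, int) cohom) \<Rightarrow> bool" where
  "is_chern_classes n E c \<longleftrightarrow>
     (\<forall>i. c i \<in> cohomology (2 * i) (Base E)) \<and>
     c 0 = \<one>\<^bsub>cohomology_ring (Base E)\<^esub> \<and>
     (\<forall>i>n. c i = \<zero>\<^bsub>cohomology_ring (Base E)\<^esub>) \<and>
     (let P = projectivization E; R = cohomology_ring P;
          \<xi> = \<ominus>\<^bsub>R\<^esub> line_bundle_c1 (tautological_bundle E)
      in finsum R (\<lambda>i. cohom_pullback P (line_foot E) (c i) \<otimes>\<^bsub>R\<^esub> (\<xi> [^]\<^bsub>R\<^esub> (n - i))) {..n} = \<zero>\<^bsub>R\<^esub>)"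

text \<open>
  The Chern classes exist and are unique for every complex vector bundle of rank \<open>n\<close>; for other
  arguments the value below is \<open>0\<close>.
\<close>
definition chern_class :: "nat \<Rightarrow> ('b, 'e) complex_bundle \<Rightarrow> nat \<Rightarrow> ('b, int) cohom" where
  "chern_class n E = (if \<exists>!c. is_chern_classes n E c then THE c. is_chern_classes n E c
     else (\<lambda>i. \<zero>\<^bsub>cohomology_ring (Base E)\<^esub>))"


section \<open>Polynomials in several variables and the Todd class\<close>

text \<open>A monomial is the finitely supported function of its exponents.\<close>
type_synonym mpoly_rat = "(nat \<Rightarrow>\<^sub>0 nat) \<Rightarrow>\<^sub>0 rat"

definition mpoly_vars :: "mpoly_rat \<Rightarrow> nat set" where
  "mpoly_vars P = (\<Union>m\<in>Poly_Mapping.keys P. Poly_Mapping.keys m)"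

definition monom_degree :: "(nat \<Rightarrow>\<^sub>0 nat) \<Rightarrow> nat" where
  "monom_degree m = (\<Sum>i\<in>Poly_Mapping.keys m. Poly_Mapping.lookup m i)"

definition mpoly_degree :: "mpoly_rat \<Rightarrow> nat" where
  "mpoly_degree P = Max (insert 0 (monom_degree ` Poly_Mapping.keys P))"

text \<open>Evaluation in an algebra with structure map \<open>h\<close>.\<close>
definition mpoly_eval :: "(rat \<Rightarrow> 'b::comm_ring_1) \<Rightarrow> (nat \<Rightarrow> 'b) \<Rightarrow> mpoly_rat \<Rightarrow> 'b" where
  "mpoly_eval h a P = (\<Sum>m\<in>Poly_Mapping.keys P. h (Poly_Mapping.lookup P m) *
     (\<Prod>i\<in>Poly_Mapping.keys m. a i ^ Poly_Mapping.lookup m i))"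

definition mpoly_var :: "nat \<Rightarrow> mpoly_rat" where
  "mpoly_var i = Poly_Mapping.single (Poly_Mapping.single i 1) 1"

definition mpoly_const :: "rat \<Rightarrow> mpoly_rat" where
  "mpoly_const r = Poly_Mapping.single 0 r"

definition homogeneous_part :: "nat \<Rightarrow> mpoly_rat \<Rightarrow> mpoly_rat" where
  "homogeneous_part d P = (\<Sum>m\<in>{m \<in> Poly_Mapping.keys P. monom_degree m = d}.
     Poly_Mapping.single m (Poly_Mapping.lookup P m))"

definition elem_sym :: "nat \<Rightarrow> nat \<Rightarrow> mpoly_rat" where
  "elem_sym n k = (\<Sum>S\<in>{S. S \<subseteq> {1..n} \<and> card S = k}. \<Prod>i\<in>S. mpoly_var i)"

text \<open>\<open>x / (1 - exp (-x))\<close>\<close>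
definition todd_series :: "rat fps" where
  "todd_series = fps_X / (1 - fps_exp (-1))"

lemma todd_series_eq: "todd_series * (1 - fps_exp (-1)) = fps_X"
proof -
  have "fps_nth (1 - fps_exp (-1) :: rat fps) 0 = 0" "fps_nth (1 - fps_exp (-1) :: rat fps) 1 = 1"
    by simp_all
  then have "subdegree (1 - fps_exp (-1) :: rat fps) = 1"
    by (intro subdegreeI) auto
  then have "(1 - fps_exp (-1)) dvd (fps_X :: rat fps)"
    by (subst fps_dvd_iff) auto
  then show ?thesis
    unfolding todd_series_def by simp
qed

text \<open>
  The Todd polynomial of degree \<open>k\<close> for bundles of rank \<open>n\<close>: it expresses the part of degree \<open>k\<close> of
  the product of the series \<open>x\<^sub>i / (1 - exp (-x\<^sub>i))\<close> over the Chern roots \<open>x\<^sub>1, \<dots>, x\<^sub>n\<close> through the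
  elementary symmetric polynomials. Truncating each series at degree \<open>k\<close> does not affect that part.
\<close>
definition todd_polynomial :: "nat \<Rightarrow> nat \<Rightarrow> mpoly_rat" where
  "todd_polynomial n k = (THE P. mpoly_vars P \<subseteq> {1..n} \<and>
     mpoly_eval mpoly_const (elem_sym n) P = homogeneous_part k
       (\<Prod>i\<in>{1..n}. \<Sum>j\<le>k. mpoly_const (fps_nth todd_series j) * mpoly_var i ^ j))"

text \<open>
  The value of a polynomial at cohomology classes. The factors are multiplied in a fixed order; it is
  irrelevant for classes of even degree.
\<close>
definition cohom_eval :: "'a topology \<Rightarrow> nat \<Rightarrow> (nat \<Rightarrow> ('a, rat) cohom) \<Rightarrow> mpoly_rat \<Rightarrow> ('a, rat) cohom"
  where
  "cohom_eval X n a P = (let R = cohomology_ring X in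
     finsum R (\<lambda>m. cohom_class X (const_cochain X (Poly_Mapping.lookup P m)) \<otimes>\<^bsub>R\<^esub>
       foldr (\<lambda>i y. (a i [^]\<^bsub>R\<^esub> Poly_Mapping.lookup m i) \<otimes>\<^bsub>R\<^esub> y) [1..<Suc n] \<one>\<^bsub>R\<^esub>)
     (Poly_Mapping.keys P))"

definition todd_class :: "nat \<Rightarrow> ('b, 'e) complex_bundle \<Rightarrow> ('b, rat) cohom" where
  "todd_class n E = even_series (Base E) (\<lambda>k. cohom_eval (Base E) n
     (\<lambda>i. rationalize (Base E) (chern_class n E i)) (todd_polynomial n k))"


section \<open>Almost complex manifolds\<close>

text \<open>
  A point of \<open>\<real>\<^sup>k\<close> is a function \<^typ>\<open>nat \<Rightarrow> real\<close> vanishing from \<open>k\<close> on, as in \<^const>\<open>Euclidean_space\<close>.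
  A chart is a pair of its domain and its coordinate map; the values of the latter outside the
  domain play no role.
\<close>

type_synonym 'a chart = "'a set \<times> ('a \<Rightarrow> nat \<Rightarrow> real)"

definition partial_deriv :: "nat \<Rightarrow> ((nat \<Rightarrow> real) \<Rightarrow> real) \<Rightarrow> (nat \<Rightarrow> real) \<Rightarrow> real" where
  "partial_deriv i f x = deriv (\<lambda>t. f (x(i := t))) (x i)"

text \<open>All iterated partial derivatives exist and are continuous on the open set \<open>V\<close>.\<close>
definition smooth_on :: "nat \<Rightarrow> (nat \<Rightarrow> real) set \<Rightarrow> ((nat \<Rightarrow> real) \<Rightarrow> real) \<Rightarrow> bool" where
  "smooth_on k V f \<longleftrightarrow> (\<forall>js. set js \<subseteq> {..<k} \<longrightarrow>
     continuous_map (subtopology (Euclidean_space k) V) euclideanreal (foldr partial_deriv js f) \<and>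
     (\<forall>i<k. \<forall>x\<in>V. (\<lambda>t. foldr partial_deriv js f (x(i := t))) differentiable (at (x i))))"

definition transition :: "'a chart \<Rightarrow> 'a chart \<Rightarrow> (nat \<Rightarrow> real) \<Rightarrow> nat \<Rightarrow> real" where
  "transition c d x = snd d (inv_into (fst c) (snd c) x)"

definition smooth_atlas :: "nat \<Rightarrow> 'a topology \<Rightarrow> 'a chart set \<Rightarrow> bool" where
  "smooth_atlas k X A \<longleftrightarrow>
     (\<forall>(U, \<phi>)\<in>A. openin X U \<and> openin (Euclidean_space k) (\<phi> ` U) \<and>
        homeomorphic_map (subtopology X U) (subtopology (Euclidean_space k) (\<phi> ` U)) \<phi>) \<and>
     \<Union> (fst ` A) = topspace X \<and>
     (\<forall>c\<in>A. \<forall>d\<in>A. \<forall>i<k. smooth_on k (snd c ` (fst c \<inter> fst d)) (\<lambda>x. transition c d x i))"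

definition smooth_manifold :: "nat \<Rightarrow> 'a topology \<Rightarrow> 'a chart set \<Rightarrow> bool" where
  "smooth_manifold k X A \<longleftrightarrow> Hausdorff_space X \<and> second_countable X \<and> smooth_atlas k X A"

text \<open>
  A tangent vector is a pair of a point and the family of its coordinate vectors in the charts around
  that point, which are related by the differentials of the transition maps.
\<close>
type_synonym 'a tangent = "'a \<times> ('a chart \<Rightarrow> nat \<Rightarrow> real)"

definition tangent_vectors :: "nat \<Rightarrow> 'a chart set \<Rightarrow> 'a tangent set" where
  "tangent_vectors k A = {(p, v). p \<in> \<Union> (fst ` A) \<and>
     (\<forall>c. if c \<in> A \<and> p \<in> fst c then v c \<in> topspace (Euclidean_space k) else v c = (\<lambda>i. 0)) \<and>
     (\<forall>c\<in>A. \<forall>d\<in>A. p \<in> fst c \<inter> fst d \<longrightarrow> (\<forall>i<k. v d i =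
        (\<Sum>j<k. partial_deriv j (\<lambda>x. transition c d x i) (snd c p) * v c j)))}"

definition tangent_topology :: "nat \<Rightarrow> 'a chart set \<Rightarrow> 'a tangent topology" where
  "tangent_topology k A = topology_generated_by
     {{t \<in> tangent_vectors k A. fst t \<in> fst c \<and> (snd c (fst t), snd t c) \<in> W} | c W.
        c \<in> A \<and> openin (prod_topology (Euclidean_space k) (Euclidean_space k)) W}"

definition almost_complex_structure ::
  "nat \<Rightarrow> 'a chart set \<Rightarrow> ('a tangent \<Rightarrow> 'a tangent) \<Rightarrow> bool" where
  "almost_complex_structure k A J \<longleftrightarrow>
     (\<forall>t\<in>tangent_vectors k A. J t \<in> tangent_vectors k A \<and> fst (J t) = fst t \<and>
        J (J t) = (fst t, \<lambda>c i. - snd t c i)) \<and>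
     (\<forall>c\<in>A. \<exists>a. (\<forall>i<k. \<forall>j<k. smooth_on k (snd c ` fst c) (a i j)) \<and>
        (\<forall>t\<in>tangent_vectors k A. fst t \<in> fst c \<longrightarrow> (\<forall>i<k. snd (J t) c i =
           (\<Sum>j<k. a i j (snd c (fst t)) * snd t c j))))"

text \<open>Almost complex manifolds of real dimension \<open>2 n\<close>.\<close>
definition almost_complex_manifold ::
  "nat \<Rightarrow> 'a topology \<Rightarrow> 'a chart set \<Rightarrow> ('a tangent \<Rightarrow> 'a tangent) \<Rightarrow> bool" where
  "almost_complex_manifold n X A J \<longleftrightarrow>
     smooth_manifold (2 * n) X A \<and> almost_complex_structure (2 * n) A J"

definition tangent_bundle ::
  "nat \<Rightarrow> 'a topology \<Rightarrow> 'a chart set \<Rightarrow> ('a tangent \<Rightarrow> 'a tangent) \<Rightarrow> ('a, 'a tangent) complex_bundle"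
  where
  "tangent_bundle n X A J = \<lparr>
     Base = X,
     Total = tangent_topology (2 * n) A,
     Proj = fst,
     Zero = (\<lambda>p. (p, \<lambda>c i. 0)),
     Scale = (\<lambda>z t. (fst t, \<lambda>c i. Re z * snd t c i + Im z * snd (J t) c i))\<rparr>"

text \<open>
  A small affine \<open>2 n\<close>-simplex, in some chart, with barycentre \<open>p\<close>. If \<open>x\<close> are the coordinates of \<open>p\<close>,
  its vertices are \<open>x - (w\<^sub>1 + \<dots> + w\<^sub>2\<^sub>n), x + w\<^sub>1, \<dots>, x + w\<^sub>2\<^sub>n\<close> for a basis of the form
  \<open>b\<^sub>1, J b\<^sub>1, \<dots>, b\<^sub>n, J b\<^sub>n\<close> of the tangent space at \<open>p\<close>; it is positively oriented for the orientation
  defined by \<open>J\<close>.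
\<close>
definition positive_simplex ::
  "nat \<Rightarrow> 'a chart set \<Rightarrow> ('a tangent \<Rightarrow> 'a tangent) \<Rightarrow> 'a \<Rightarrow> ((nat \<Rightarrow> real) \<Rightarrow> 'a) \<Rightarrow> bool" where
  "positive_simplex n A J p \<tau> \<longleftrightarrow> (\<exists>(U, \<phi>)\<in>A. \<exists>b.
     let w = (\<lambda>j. if even j then snd (b (j div 2)) (U, \<phi>) else snd (J (b (j div 2))) (U, \<phi>));
         l = (\<lambda>j i. if j = 0 then \<phi> p i - (\<Sum>m<2 * n. w m i) else \<phi> p i + w (j - 1) i)
     in p \<in> U \<and> (\<forall>j<n. b j \<in> tangent_vectors (2 * n) A \<and> fst (b j) = p) \<and>
        (\<forall>r. (\<forall>i<2 * n. (\<Sum>j<2 * n. r j * w j i) = 0) \<longrightarrow> (\<forall>j<2 * n. r j = 0)) \<and>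
        oriented_simplex (2 * n) l ` standard_simplex (2 * n) \<subseteq> \<phi> ` U \<and>
        \<tau> = simplex_map (2 * n) (inv_into U \<phi>) (oriented_simplex (2 * n) l))"

definition is_fundamental_class ::
  "nat \<Rightarrow> 'a topology \<Rightarrow> 'a chart set \<Rightarrow> ('a tangent \<Rightarrow> 'a tangent) \<Rightarrow> 'a chain set \<Rightarrow> bool" where
  "is_fundamental_class n X A J \<mu> \<longleftrightarrow> \<mu> \<in> carrier (homology_group (int (2 * n)) X) \<and>
     (\<forall>p\<in>topspace X. \<forall>\<tau>. positive_simplex n A J p \<tau> \<longrightarrow>
        (\<forall>z\<in>\<mu>. homologous_rel (2 * n) X (topspace X - {p}) z (frag_of \<tau>)))"

text \<open>
  The fundamental class exists and is unique for every compact almost complex manifold; for other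
  arguments the value below is \<open>0\<close>.
\<close>
definition fundamental_class ::
  "nat \<Rightarrow> 'a topology \<Rightarrow> 'a chart set \<Rightarrow> ('a tangent \<Rightarrow> 'a tangent) \<Rightarrow> 'a chain set" where
  "fundamental_class n X A J = (if \<exists>!\<mu>. is_fundamental_class n X A J \<mu>
     then THE \<mu>. is_fundamental_class n X A J \<mu> else \<one>\<^bsub>homology_group (int (2 * n)) X\<^esub>)"


section \<open>The index map and the generalized Hilbert polynomial\<close>

text \<open>The class of the first Chern class of the tangent bundle modulo torsion.\<close>
definition c1_lattice ::
  "nat \<Rightarrow> 'a topology \<Rightarrow> 'a chart set \<Rightarrow> ('a tangent \<Rightarrow> 'a tangent) \<Rightarrow> ('a, int) cohom set" where
  "c1_lattice n X A J =
     torsion (cohom2_group X) #>\<^bsub>cohom2_group X\<^esub> chern_class n (tangent_bundle n X A J) 1"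

text \<open>
  The index of the line bundle with first Chern class \<open>\<eta>\<close>, as given by the Atiyah-Singer index
  formula: \<open>(\<Sum>l. \<eta>\<^sup>l / l!) T\<close> evaluated on the fundamental class, where \<open>T\<close> is the total Todd class.
\<close>
definition index_of_class ::
  "nat \<Rightarrow> 'a topology \<Rightarrow> 'a chart set \<Rightarrow> ('a tangent \<Rightarrow> 'a tangent) \<Rightarrow> ('a, int) cohom \<Rightarrow> rat" where
  "index_of_class n X A J \<eta> = kronecker (2 * n)
     (cohom_exp X (rationalize X \<eta>) \<otimes>\<^bsub>cohomology_ring X\<^esub> todd_class n (tangent_bundle n X A J))
     (fundamental_class n X A J)"

text \<open>The induced map on \<open>H\<^sup>2(X;\<int>)\<close> modulo torsion.\<close>
definition index_map ::
  "nat \<Rightarrow> 'a topology \<Rightarrow> 'a chart set \<Rightarrow> ('a tangent \<Rightarrow> 'a tangent) \<Rightarrow> ('a, int) cohom set \<Rightarrow> rat" where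
  "index_map n X A J x = index_of_class n X A J (rep x)"

definition hilbert_polynomial ::
  "nat \<Rightarrow> 'a topology \<Rightarrow> 'a chart set \<Rightarrow> ('a tangent \<Rightarrow> 'a tangent) \<Rightarrow> nat \<Rightarrow>
     (nat \<Rightarrow> ('a, int) cohom set) \<Rightarrow> mpoly_rat" where
  "hilbert_polynomial n X A J b \<tau> = (THE P. mpoly_vars P \<subseteq> {1..b} \<and>
     (\<forall>k :: nat \<Rightarrow> int. mpoly_eval (\<lambda>r. r) (\<lambda>i. of_int (k i)) P =
        index_map n X A J (int_comb (cohom2_lattice X) b \<tau> k)))"

end

theory Submission
  imports Defs
begin

text \<open>
  The proof has a topological and a combinatorial half, which meet in the statement that the index map
  is polynomial of degree at most \<open>n\<close> in the coordinates of its argument (\<open>poly_fun_index_map\<close>).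

  Topological half. Let \<open>f\<^sub>1, \<dots>, f\<^sub>b\<close> be integral cocycles of degree 2. The class of
  \<open>k\<^sub>1 f\<^sub>1 + \<dots> + k\<^sub>b f\<^sub>b\<close> has the index \<open>\<Sum>l. (C\<^sup>l / l!) t\<close> evaluated on a cycle of dimension \<open>2 n\<close>,
  where \<open>C\<close> is that linear combination with rational coefficients and \<open>t\<close> is a cocycle of the Todd
  class. The value of the \<open>l\<close>-th cup power of \<open>C\<close> on any simplex is a polynomial in \<open>k\<close> of degree at
  most \<open>l\<close>, simply because the cup product is bilinear. Only the components of \<open>exp C\<close> of degree
  \<open>2 l \<le> 2 n\<close> meet the cycle, and the one of degree \<open>2 l\<close> comes from \<open>C\<^sup>l\<close>; hence the bound \<open>n\<close>. Computing
  with representatives is legitimate since cocycles form a ring in which the coboundaries are an ideal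
  (\<open>ring_cocycle_ring\<close>, \<open>ideal_coboundaries\<close>, both resting on \<open>coboundary_cup\<close>), since a cycle pairs
  to zero with coboundaries, and since torsion classes vanish over the rationals.

  Combinatorial half. For a monomial \<open>u\<close> with exponents \<open>e\<^sub>i\<close>, the mixed difference operator of order
  \<open>e\<^sub>i\<close> in the \<open>i\<close>-th variable sends a polynomial of degree at most \<open>\<Sum>i. e\<^sub>i\<close> to \<open>\<Prod>i. e\<^sub>i!\<close> times its
  coefficient at \<open>u\<close> (\<open>coefficient_formula\<close>). Applied to a monomial of maximal degree, this shows that a
  polynomial is determined by its values at integer points, so the Hilbert polynomial \<open>H\<close> is indeed the
  polynomial found above. Applied with \<open>e\<^sub>i = m\<^sub>i - 1\<close> to \<open>G(k) =\<close> index of \<open>k\<^sub>1 \<eta>\<^sub>1 + \<dots> + k\<^sub>b \<eta>\<^sub>b\<close> on the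
  grid of all \<open>-k\<close> with \<open>0 < k\<^sub>i \<le> m\<^sub>i\<close>, it gives the lower bound: by hypothesis only the corner \<open>k = m\<close>
  contributes, with a nonzero value, so \<open>G\<close> cannot have degree less than \<open>\<Sum>i. (m\<^sub>i - 1)\<close>
  (\<open>degree_lower_bound\<close>). As the \<open>\<eta>\<^sub>i\<close> are integral combinations of the basis \<open>\<tau>\<close>, \<open>G\<close> arises from \<open>H\<close> by a
  linear substitution, so its degree is at most that of \<open>H\<close>.
\<close>

section \<open>Front and back faces of singular simplices\<close>

lemma singular_simplex_front_face:
  assumes "singular_simplex q X \<sigma>" "p \<le> q"
  shows "singular_simplex p X (front_face p \<sigma>)"
proof -
  have "continuous_map (subtopology (powertop_real UNIV) (standard_simplex p)) X \<sigma>"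
    using assms standard_simplex_mono[OF assms(2)] continuous_map_from_subtopology_mono
    unfolding singular_simplex_def by blast
  then show ?thesis
    unfolding singular_simplex_def front_face_def
    by (auto intro: continuous_map_eq)
qed

lemma front_face_self: "singular_simplex p X \<sigma> \<Longrightarrow> front_face p \<sigma> = \<sigma>"
  by (simp add: front_face_def singular_simplex_def extensional_restrict)

lemma back_face_0: "singular_simplex p X \<sigma> \<Longrightarrow> back_face 0 p \<sigma> = \<sigma>"
  by (simp add: back_face_def singular_simplex_def extensional_restrict)

lemma front_face_front_face: "i \<le> j \<Longrightarrow> front_face i (front_face j \<sigma>) = front_face i \<sigma>"
  using standard_simplex_mono[of i j] by (auto simp: front_face_def restrict_def fun_eq_iff)

lemma singular_face_eq_simplical:
  "x \<in> standard_simplex p \<Longrightarrow> singular_face (Suc p) k f x = f (simplical_face k x)"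
  by (simp add: singular_face_def)

text \<open>
  Dropping the first vertices one at a time reduces back faces to iterated zeroth faces, so that the
  properties of single faces apply.
\<close>
lemma back_face_Suc:
  "back_face (Suc p) q \<sigma> = singular_face (Suc q) 0 (back_face p (Suc q) \<sigma>)"
proof
  fix x
  show "back_face (Suc p) q \<sigma> x = singular_face (Suc q) 0 (back_face p (Suc q) \<sigma>) x"
  proof (cases "x \<in> standard_simplex q")
    case True
    have "(\<lambda>i. if i < Suc p then 0 else x (i - Suc p)) =
          (\<lambda>i. if i < p then 0 else simplical_face 0 x (i - p))"
      by (auto simp: simplical_face_def fun_eq_iff)
    with True show ?thesis
      using simplical_face_in_standard_simplex[of "Suc q" 0 x]
      by (simp add: back_face_def singular_face_eq_simplical)
  qed (simp add: back_face_def singular_face_def)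
qed

lemma singular_simplex_back_face:
  "singular_simplex (p + q) X \<sigma> \<Longrightarrow> singular_simplex q X (back_face p q \<sigma>)"
proof (induction p arbitrary: q)
  case 0
  then show ?case by (simp add: back_face_0)
next
  case (Suc p)
  then have "singular_simplex (Suc q) X (back_face p (Suc q) \<sigma>)" by simp
  from singular_simplex_singular_face[OF this, of 0] show ?case
    by (simp add: back_face_Suc)
qed

lemma shift_in_standard_simplex:
  fixes x :: "nat \<Rightarrow> real"
  assumes "x \<in> standard_simplex q"
  shows "(\<lambda>i. if i < p then 0 else x (i - p)) \<in> standard_simplex (p + q)"
proof (induction p)
  case (Suc p)
  have "(\<lambda>i. if i < Suc p then 0 else x (i - Suc p)) =
      simplical_face 0 (\<lambda>i. if i < p then 0 else x (i - p))"
    by (auto simp: simplical_face_def fun_eq_iff)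
  with Suc show ?case
    using simplical_face_in_standard_simplex[of "Suc (p + q)" 0] by simp
qed (use assms in simp)

lemma back_face_back_face:
  "back_face i r (back_face j (i + r) \<sigma>) = back_face (j + i) r \<sigma>"
proof
  fix x
  show "back_face i r (back_face j (i + r) \<sigma>) x = back_face (j + i) r \<sigma> x"
  proof (cases "x \<in> standard_simplex r")
    case True
    have "(\<lambda>k. if k < j then 0 else if k - j < i then 0 else x (k - j - i)) =
        (\<lambda>k. if k < j + i then 0 else x (k - (j + i)))"
      by (auto simp: fun_eq_iff)
    then show ?thesis
      using True shift_in_standard_simplex[OF True, of i] by (simp add: back_face_def)
  qed (simp add: back_face_def)
qed

lemma front_face_back_face:
  assumes "i \<le> q"
  shows "front_face i (back_face j q \<sigma>) = back_face j i (front_face (j + i) \<sigma>)"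
proof
  fix x
  show "front_face i (back_face j q \<sigma>) x = back_face j i (front_face (j + i) \<sigma>) x"
    using standard_simplex_mono[OF assms] shift_in_standard_simplex[of x i j]
    by (auto simp: front_face_def back_face_def restrict_def)
qed

lemma front_face_singular_face_le:
  assumes "j \<le> Suc i" "i \<le> p"
  shows "front_face i (singular_face (Suc p) j \<sigma>) = singular_face (Suc i) j (front_face (Suc i) \<sigma>)"
proof
  fix x
  show "front_face i (singular_face (Suc p) j \<sigma>) x = singular_face (Suc i) j (front_face (Suc i) \<sigma>) x"
  proof (cases "x \<in> standard_simplex i")
    case True
    with assms standard_simplex_mono[of i p] simplical_face_in_standard_simplex[of "Suc i" j x]
    show ?thesis by (auto simp: front_face_def singular_face_def)
  qed (simp add: front_face_def singular_face_def)
qed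

lemma simplical_face_beyond:
  fixes x :: "nat \<Rightarrow> real"
  assumes "x \<in> standard_simplex i" "i < j"
  shows "simplical_face j x = x"
  using assms by (auto simp: simplical_face_def standard_simplex_def fun_eq_iff)

lemma front_face_singular_face_gt:
  assumes "i < j" "i \<le> p"
  shows "front_face i (singular_face (Suc p) j \<sigma>) = front_face i \<sigma>"
proof
  fix x
  show "front_face i (singular_face (Suc p) j \<sigma>) x = front_face i \<sigma> x"
    using assms standard_simplex_mono[of i p]
    by (auto simp: front_face_def singular_face_def restrict_def simplical_face_beyond)
qed

lemma back_face_singular_face_le:
  assumes "j \<le> i" "i \<le> p"
  shows "back_face i (p - i) (singular_face (Suc p) j \<sigma>) = back_face (Suc i) (p - i) \<sigma>"
proof
  fix x
  show "back_face i (p - i) (singular_face (Suc p) j \<sigma>) x = back_face (Suc i) (p - i) \<sigma> x"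
  proof (cases "x \<in> standard_simplex (p - i)")
    case True
    have "simplical_face j (\<lambda>k. if k < i then 0 else x (k - i)) =
        (\<lambda>k. if k < Suc i then 0 else x (k - Suc i))"
      using assms by (auto simp: simplical_face_def fun_eq_iff)
    then show ?thesis
      using True shift_in_standard_simplex[OF True, of i] assms
      by (simp add: back_face_def singular_face_def)
  qed (simp add: back_face_def)
qed

lemma back_face_singular_face_gt:
  assumes "j \<le> Suc (p - i)" "i \<le> p"
  shows "back_face i (p - i) (singular_face (Suc p) (i + j) \<sigma>) =
    singular_face (Suc (p - i)) j (back_face i (Suc (p - i)) \<sigma>)"
proof
  fix x
  show "back_face i (p - i) (singular_face (Suc p) (i + j) \<sigma>) x =
    singular_face (Suc (p - i)) j (back_face i (Suc (p - i)) \<sigma>) x"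
  proof (cases "x \<in> standard_simplex (p - i)")
    case True
    have "simplical_face (i + j) (\<lambda>k. if k < i then 0 else x (k - i)) =
        (\<lambda>k. if k < i then 0 else simplical_face j x (k - i))"
      by (auto simp: simplical_face_def fun_eq_iff)
    then show ?thesis
      using True shift_in_standard_simplex[OF True, of i] assms
        simplical_face_in_standard_simplex[of "Suc (p - i)" j x]
      by (simp add: back_face_def singular_face_def)
  qed (simp add: back_face_def singular_face_def)
qed

section \<open>The Leibniz rule for the cup product\<close>

text \<open>
  The sign \<open>(-1)\<^sup>|\<^sup>f\<^sup>|\<close> of the Leibniz rule \<open>\<delta>(f g) = (\<delta>f) g + (-1)\<^sup>|\<^sup>f\<^sup>| f (\<delta>g)\<close>, distributed over the
  components of an inhomogeneous cochain.
\<close>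
definition grade_sign :: "('a, 'r::comm_ring_1) cochain \<Rightarrow> ('a, 'r) cochain" where
  "grade_sign f = (\<lambda>p \<sigma>. (-1) ^ p * f p \<sigma>)"

lemma singular_simplex_face_Suc:
  "singular_simplex (Suc q) X \<sigma> \<Longrightarrow> j \<le> Suc q \<Longrightarrow> singular_simplex q X (singular_face (Suc q) j \<sigma>)"
  using singular_simplex_singular_face[of "Suc q" X \<sigma> j] by simp

text \<open>
  Fix the degree \<open>i\<close> of the component of \<open>f\<close>. Among the faces \<open>j\<close> of a simplex of dimension \<open>q + 1\<close>,
  those with \<open>j \<le> i\<close> restrict to faces of its front face of dimension \<open>i + 1\<close> and those with \<open>j > i\<close> to
  faces of its back face of dimension \<open>q - i + 1\<close>. The first kind lacks the last face of the front
  part, the second kind the zeroth face of the back part; these two missing terms are equal up to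
  sign and cancel.
\<close>
theorem coboundary_cup:
  fixes f g :: "('a, 'r::comm_ring_1) cochain"
  shows "coboundary X (cup X f g) =
    (\<lambda>p \<sigma>. cup X (coboundary X f) g p \<sigma> + cup X (grade_sign f) (coboundary X g) p \<sigma>)"
proof (intro ext)
  fix p \<sigma>
  show "coboundary X (cup X f g) p \<sigma> =
    cup X (coboundary X f) g p \<sigma> + cup X (grade_sign f) (coboundary X g) p \<sigma>"
  proof (cases "0 < p \<and> singular_simplex p X \<sigma>")
    case False
    then show ?thesis
      by (auto simp: coboundary_def cup_def)
  next
    case True
    then obtain q where p: "p = Suc q" and s: "singular_simplex (Suc q) X \<sigma>"
      using gr0_conv_Suc by auto
    define A where "A i j = f i (front_face i (singular_face (Suc q) j \<sigma>)) *
      g (q - i) (back_face i (q - i) (singular_face (Suc q) j \<sigma>))" for i j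
    define B where "B i j = f i (singular_face (Suc i) j (front_face (Suc i) \<sigma>)) *
      g (q - i) (back_face (Suc i) (q - i) \<sigma>)" for i j
    define C where "C i j = f i (front_face i \<sigma>) *
      g (q - i) (singular_face (Suc (q - i)) j (back_face i (Suc (q - i)) \<sigma>))" for i j
    have "coboundary X (cup X f g) p \<sigma> = (\<Sum>j\<le>Suc q. (-1) ^ j * (\<Sum>i\<le>q. A i j))"
      using s unfolding p coboundary_def cup_def A_def
      by (auto intro!: sum.cong simp: singular_simplex_face_Suc simp del: sum.atMost_Suc)
    also have "\<dots> = (\<Sum>i\<le>q. \<Sum>j\<le>Suc q. (-1) ^ j * A i j)"
      unfolding sum_distrib_left by (rule sum.swap)
    also have "\<dots> = (\<Sum>i\<le>q. (\<Sum>j\<le>Suc i. (-1) ^ j * B i j) + (\<Sum>j\<le>Suc (q - i). (-1) ^ (i + j) * C i j))"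
    proof (rule sum.cong)
      fix i
      assume "i \<in> {..q}"
      then have i: "i \<le> q" by simp
      have AB: "A i j = B i j" if "j \<le> i" for j
        using that i unfolding A_def B_def
        by (simp add: front_face_singular_face_le back_face_singular_face_le)
      have AC: "A i (i + Suc j) = C i (Suc j)" if "j \<le> q - i" for j
        using that i unfolding A_def C_def
        by (subst front_face_singular_face_gt back_face_singular_face_gt; simp)+
      have BC: "B i (Suc i) = C i 0"
        using front_face_singular_face_le[of "Suc i" i i \<sigma>] front_face_singular_face_gt[of i "Suc i" i \<sigma>]
        by (simp add: B_def C_def back_face_Suc)
      have "(\<Sum>j\<le>Suc q. (-1) ^ j * A i j) = (\<Sum>j\<le>i + Suc (q - i). (-1) ^ j * A i j)"
        using i by simp
      also have "\<dots> = (\<Sum>j\<le>i. (-1) ^ j * A i j) + (\<Sum>j = Suc i..i + Suc (q - i). (-1) ^ j * A i j)"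
        by (rule sum_up_index_split)
      also have "(\<Sum>j = Suc i..i + Suc (q - i). (-1) ^ j * A i j) =
          (\<Sum>j\<le>q - i. (-1) ^ (i + Suc j) * A i (i + Suc j))"
        by (rule sum.reindex_bij_witness[of _ "\<lambda>j. i + Suc j" "\<lambda>j. j - Suc i"]) auto
      also have "\<dots> = (\<Sum>j\<le>q - i. (-1) ^ (i + Suc j) * C i (Suc j))"
        using AC by simp
      also have "\<dots> = (\<Sum>j\<le>Suc (q - i). (-1) ^ (i + j) * C i j) - (-1) ^ i * C i 0"
        by (subst sum.atMost_Suc_shift) simp
      also have "(\<Sum>j\<le>i. (-1) ^ j * A i j) = (\<Sum>j\<le>Suc i. (-1) ^ j * B i j) + (-1) ^ i * B i (Suc i)"
        using AB by simp
      finally show "(\<Sum>j\<le>Suc q. (-1) ^ j * A i j) =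
          (\<Sum>j\<le>Suc i. (-1) ^ j * B i j) + (\<Sum>j\<le>Suc (q - i). (-1) ^ (i + j) * C i j)"
        by (simp add: BC)
    qed simp
    also have "\<dots> = (\<Sum>i\<le>q. \<Sum>j\<le>Suc i. (-1) ^ j * B i j) + (\<Sum>i\<le>q. \<Sum>j\<le>Suc (q - i). (-1) ^ (i + j) * C i j)"
      by (rule sum.distrib)
    also have "(\<Sum>i\<le>q. \<Sum>j\<le>Suc i. (-1) ^ j * B i j) = cup X (coboundary X f) g p \<sigma>"
    proof -
      have "cup X (coboundary X f) g p \<sigma> =
          (\<Sum>i\<le>q. coboundary X f (Suc i) (front_face (Suc i) \<sigma>) * g (q - i) (back_face (Suc i) (q - i) \<sigma>))"
        using s by (simp add: p cup_def sum.atMost_Suc_shift coboundary_def del: sum.atMost_Suc)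
      also have "\<dots> = (\<Sum>i\<le>q. \<Sum>j\<le>Suc i. (-1) ^ j * B i j)"
        using s singular_simplex_front_face[OF s]
        by (intro sum.cong refl)
          (simp add: coboundary_def B_def sum_distrib_right mult.assoc del: sum.atMost_Suc)
      finally show ?thesis by simp
    qed
    also have "(\<Sum>i\<le>q. \<Sum>j\<le>Suc (q - i). (-1) ^ (i + j) * C i j) =
        cup X (grade_sign f) (coboundary X g) p \<sigma>"
    proof -
      have "cup X (grade_sign f) (coboundary X g) p \<sigma> =
          (\<Sum>i\<le>q. grade_sign f i (front_face i \<sigma>) * coboundary X g (Suc q - i) (back_face i (Suc q - i) \<sigma>))"
        using s by (simp add: p cup_def coboundary_def)
      also have "\<dots> = (\<Sum>i\<le>q. \<Sum>j\<le>Suc (q - i). (-1) ^ (i + j) * C i j)"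
      proof (rule sum.cong)
        fix i
        assume "i \<in> {..q}"
        then have i: "Suc q - i = Suc (q - i)" "i + Suc (q - i) = Suc q" by auto
        then have "singular_simplex (Suc (q - i)) X (back_face i (Suc (q - i)) \<sigma>)"
          using singular_simplex_back_face[of i "Suc (q - i)" X \<sigma>] s by simp
        then show "grade_sign f i (front_face i \<sigma>) * coboundary X g (Suc q - i) (back_face i (Suc q - i) \<sigma>) =
            (\<Sum>j\<le>Suc (q - i). (-1) ^ (i + j) * C i j)"
          unfolding i(1)
          by (simp add: coboundary_def C_def grade_sign_def sum_distrib_left power_add mult_ac del: sum.atMost_Suc)
      qed simp
      finally show ?thesis by simp
    qed
    finally show ?thesis .
  qed
qed

section \<open>Pairing of cochains with chains\<close>

definition chain_pairing :: "(((nat \<Rightarrow> real) \<Rightarrow> 'a) \<Rightarrow> 'r::comm_ring_1) \<Rightarrow> 'a chain \<Rightarrow> 'r" where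
  "chain_pairing \<phi> c = (\<Sum>\<sigma>\<in>Poly_Mapping.keys c. of_int (Poly_Mapping.lookup c \<sigma>) * \<phi> \<sigma>)"

lemma chain_pairing_superset:
  assumes "finite S" "Poly_Mapping.keys c \<subseteq> S"
  shows "chain_pairing \<phi> c = (\<Sum>\<sigma>\<in>S. of_int (Poly_Mapping.lookup c \<sigma>) * \<phi> \<sigma>)"
  unfolding chain_pairing_def using assms
  by (intro sum.mono_neutral_left) (auto simp: in_keys_iff)

lemma chain_pairing_0 [simp]: "chain_pairing \<phi> 0 = 0"
  by (simp add: chain_pairing_def)

lemma chain_pairing_of [simp]: "chain_pairing \<phi> (frag_of \<sigma>) = \<phi> \<sigma>"
  by (simp add: chain_pairing_def)

lemma chain_pairing_cmul [simp]: "chain_pairing \<phi> (frag_cmul k c) = of_int k * chain_pairing \<phi> c"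
  by (subst chain_pairing_superset[of "Poly_Mapping.keys c"])
    (auto simp: chain_pairing_def sum_distrib_left mult.assoc)

lemma chain_pairing_add: "chain_pairing \<phi> (c + d) = chain_pairing \<phi> c + chain_pairing \<phi> d"
proof -
  let ?S = "Poly_Mapping.keys c \<union> Poly_Mapping.keys d"
  have S: "finite ?S" "Poly_Mapping.keys (c + d) \<subseteq> ?S" "Poly_Mapping.keys c \<subseteq> ?S" "Poly_Mapping.keys d \<subseteq> ?S"
    using keys_add[of c d] by auto
  show ?thesis
    by (simp add: chain_pairing_superset[OF S(1,2)] chain_pairing_superset[OF S(1,3)]
        chain_pairing_superset[OF S(1,4)] lookup_add distrib_right sum.distrib)
qed

lemma chain_pairing_diff: "chain_pairing \<phi> (c - d) = chain_pairing \<phi> c - chain_pairing \<phi> d"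
  using chain_pairing_add[of \<phi> "c - d" d] by simp

lemma chain_pairing_sum: "chain_pairing \<phi> (sum c I) = (\<Sum>i\<in>I. chain_pairing \<phi> (c i))"
  by (induction I rule: infinite_finite_induct) (auto simp: chain_pairing_add)

lemma chain_pairing_fun_add:
  "chain_pairing (\<lambda>\<sigma>. \<phi> \<sigma> + \<psi> \<sigma>) c = chain_pairing \<phi> c + chain_pairing \<psi> c"
  by (simp add: chain_pairing_def distrib_left sum.distrib)

lemma chain_pairing_coboundary:
  assumes "singular_chain p X c"
  shows "chain_pairing (coboundary X f p) c = chain_pairing (f (p - 1)) (chain_boundary p c)"
  using assms unfolding singular_chain_def
proof (induction c rule: frag_induction)
  case (one \<sigma>)
  then show ?case
    by (simp add: coboundary_def chain_boundary_of chain_pairing_sum del: sum.atMost_Suc)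
next
  case (diff a b)
  then show ?case
    by (simp add: chain_pairing_diff chain_boundary_diff)
qed simp

text \<open>
  The coboundary is dual to the boundary of chains, whose square is zero.
\<close>
lemma coboundary_coboundary: "coboundary X (coboundary X f) = (\<lambda>p \<sigma>. 0)"
proof (intro ext)
  fix p \<sigma>
  show "coboundary X (coboundary X f) p \<sigma> = 0"
  proof (cases "singular_simplex p X \<sigma>")
    case True
    then have c: "singular_chain p X (frag_of \<sigma>)"
      by (simp add: singular_chain_of)
    have "coboundary X (coboundary X f) p \<sigma> = chain_pairing (coboundary X f (p - 1)) (chain_boundary p (frag_of \<sigma>))"
      using chain_pairing_coboundary[OF c, of "coboundary X f"] by simp
    also have "\<dots> = chain_pairing (f (p - 1 - 1)) (chain_boundary (p - 1) (chain_boundary p (frag_of \<sigma>)))"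
      using singular_chain_boundary[OF c] by (intro chain_pairing_coboundary) simp
    also have "\<dots> = 0"
      using chain_boundary_boundary[OF c] by simp
    finally show ?thesis .
  qed (simp add: coboundary_def)
qed

section \<open>The ring of cocycles and its ideal of coboundaries\<close>

lemma coboundary_add:
  "coboundary X (\<lambda>p \<sigma>. f p \<sigma> + g p \<sigma>) = (\<lambda>p \<sigma>. coboundary X f p \<sigma> + coboundary X g p \<sigma>)"
  by (auto simp: coboundary_def fun_eq_iff distrib_left sum.distrib simp del: sum.atMost_Suc)

lemma coboundary_scale:
  "coboundary X (\<lambda>p \<sigma>. r * f p \<sigma>) = (\<lambda>p \<sigma>. r * coboundary X f p \<sigma>)"
  by (auto simp: coboundary_def fun_eq_iff sum_distrib_left mult_ac simp del: sum.atMost_Suc)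

lemma coboundary_uminus: "coboundary X (\<lambda>p \<sigma>. - f p \<sigma>) = (\<lambda>p \<sigma>. - coboundary X f p \<sigma>)"
  using coboundary_scale[of X "-1" f] by simp

lemma coboundary_zero: "coboundary X (\<lambda>p \<sigma>. 0) = (\<lambda>p \<sigma>. 0)"
  by (auto simp: coboundary_def fun_eq_iff)

lemma coboundary_grade_sign:
  "coboundary X (grade_sign f) = (\<lambda>p \<sigma>. - grade_sign (coboundary X f) p \<sigma>)"
proof (intro ext)
  fix p \<sigma>
  show "coboundary X (grade_sign f) p \<sigma> = - grade_sign (coboundary X f) p \<sigma>"
    by (cases p) (auto simp: coboundary_def grade_sign_def sum_distrib_left sum_negf mult_ac simp del: sum.atMost_Suc)
qed

lemma grade_sign_grade_sign [simp]: "grade_sign (grade_sign f) = f"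
  by (simp add: grade_sign_def fun_eq_iff flip: mult.assoc power_mult_distrib)

lemma cup_zero_left [simp]: "cup X (\<lambda>p \<sigma>. 0) g = (\<lambda>p \<sigma>. 0)"
  and cup_zero_right [simp]: "cup X f (\<lambda>p \<sigma>. 0) = (\<lambda>p \<sigma>. 0)"
  by (auto simp: cup_def fun_eq_iff)

lemma cup_add_left:
  "cup X (\<lambda>p \<sigma>. f p \<sigma> + g p \<sigma>) h = (\<lambda>p \<sigma>. cup X f h p \<sigma> + cup X g h p \<sigma>)"
  and cup_add_right:
  "cup X h (\<lambda>p \<sigma>. f p \<sigma> + g p \<sigma>) = (\<lambda>p \<sigma>. cup X h f p \<sigma> + cup X h g p \<sigma>)"
  by (auto simp: cup_def fun_eq_iff distrib_left distrib_right sum.distrib)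

lemma cup_const_left: "f \<in> cochains X \<Longrightarrow> cup X (const_cochain X r) f = (\<lambda>p \<sigma>. r * f p \<sigma>)"
proof (intro ext)
  fix p \<sigma>
  assume f: "f \<in> cochains X"
  show "cup X (const_cochain X r) f p \<sigma> = r * f p \<sigma>"
  proof (cases "singular_simplex p X \<sigma>")
    case True
    have "cup X (const_cochain X r) f p \<sigma> =
        (\<Sum>i\<le>p. const_cochain X r i (front_face i \<sigma>) * f (p - i) (back_face i (p - i) \<sigma>))"
      using True by (simp add: cup_def)
    also have "\<dots> = (\<Sum>i\<in>{0}. const_cochain X r i (front_face i \<sigma>) * f (p - i) (back_face i (p - i) \<sigma>))"
      by (rule sum.mono_neutral_right) (auto simp: const_cochain_def)
    also have "\<dots> = r * f p \<sigma>"
      using True singular_simplex_front_face[OF True, of 0] by (simp add: const_cochain_def back_face_0)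
    finally show ?thesis .
  qed (use f in \<open>simp add: cup_def cochains_def\<close>)
qed

lemma cup_one_right: "f \<in> cochains X \<Longrightarrow> cup X f (const_cochain X 1) = f"
proof (intro ext)
  fix p \<sigma>
  assume f: "f \<in> cochains X"
  show "cup X f (const_cochain X 1) p \<sigma> = f p \<sigma>"
  proof (cases "singular_simplex p X \<sigma>")
    case True
    have "cup X f (const_cochain X 1) p \<sigma> =
        (\<Sum>i\<le>p. f i (front_face i \<sigma>) * const_cochain X 1 (p - i) (back_face i (p - i) \<sigma>))"
      using True by (simp add: cup_def)
    also have "\<dots> = (\<Sum>i\<in>{p}. f i (front_face i \<sigma>) * const_cochain X 1 (p - i) (back_face i (p - i) \<sigma>))"
      by (rule sum.mono_neutral_right) (auto simp: const_cochain_def)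
    also have "\<dots> = f p \<sigma>"
      using True singular_simplex_back_face[of p 0 X \<sigma>] by (simp add: const_cochain_def front_face_self)
    finally show ?thesis .
  qed (use f in \<open>simp add: cup_def cochains_def\<close>)
qed

text \<open>
  Both sides sum, over all ways to cut \<open>p\<close> into \<open>i + j + k\<close>, the product of \<open>f\<close>, \<open>g\<close> and \<open>h\<close> on the front,
  middle and back part of the simplex.
\<close>
lemma cup_assoc: "cup X (cup X f g) h = cup X f (cup X g h)"
proof (intro ext)
  fix p \<sigma>
  show "cup X (cup X f g) h p \<sigma> = cup X f (cup X g h) p \<sigma>"
  proof (cases "singular_simplex p X \<sigma>")
    case s: True
    define t where "t i j k = f i (front_face i \<sigma>) * (g j (back_face i j (front_face (i + j) \<sigma>)) *
      h k (back_face (i + j) k \<sigma>))" for i j k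
    have "cup X (cup X f g) h p \<sigma> = (\<Sum>m\<le>p. \<Sum>i\<le>m. t i (m - i) (p - m))"
      unfolding cup_def[of X "cup X f g"] using s
      by (auto intro!: sum.cong simp: cup_def singular_simplex_front_face front_face_front_face
          sum_distrib_right mult.assoc t_def)
    also have "\<dots> = (\<Sum>(m, i)\<in>(SIGMA m:{..p}. {..m}). t i (m - i) (p - m))"
      by (simp add: sum.Sigma)
    also have "\<dots> = (\<Sum>(i, j)\<in>(SIGMA i:{..p}. {..p - i}). t i j (p - i - j))"
      by (rule sum.reindex_bij_witness[of _ "\<lambda>(i, j). (i + j, i)" "\<lambda>(m, i). (i, m - i)"]) auto
    also have "\<dots> = (\<Sum>i\<le>p. \<Sum>j\<le>p - i. t i j (p - i - j))"
      by (simp add: sum.Sigma)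
    also have "\<dots> = cup X f (cup X g h) p \<sigma>"
      unfolding cup_def[of X f]
    proof (subst if_P[OF s], rule sum.cong)
      fix i
      assume "i \<in> {..p}"
      then have i: "i + (p - i) = p" by simp
      then have b: "singular_simplex (p - i) X (back_face i (p - i) \<sigma>)"
        using singular_simplex_back_face[of i "p - i" X \<sigma>] s by simp
      have "back_face j (p - i - j) (back_face i (p - i) \<sigma>) = back_face (i + j) (p - i - j) \<sigma>"
        if "j \<le> p - i" for j
      proof -
        have "j + (p - i - j) = p - i" using that by simp
        then show ?thesis using back_face_back_face[of j "p - i - j" i \<sigma>] by metis
      qed
      then show "(\<Sum>j\<le>p - i. t i j (p - i - j)) =
          f i (front_face i \<sigma>) * cup X g h (p - i) (back_face i (p - i) \<sigma>)"
        using b by (simp add: cup_def t_def sum_distrib_left front_face_back_face)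
    qed simp
    finally show ?thesis .
  qed (simp add: cup_def)
qed

lemma const_cochain_cocycle: "const_cochain X r \<in> cocycles X"
proof -
  have "coboundary X (const_cochain X r) p \<sigma> = 0" for p \<sigma>
  proof (cases "0 < p \<and> singular_simplex p X \<sigma>")
    case True
    then show ?thesis
      using singular_simplex_singular_face[of p X \<sigma>]
      by (cases "p = 1") (auto simp: coboundary_def const_cochain_def)
  qed (simp only: coboundary_def if_False)
  then show ?thesis
    by (auto simp: cocycles_def cochains_def const_cochain_def)
qed

lemma cup_cocycles:
  assumes "f \<in> cocycles X" "g \<in> cocycles X"
  shows "cup X f g \<in> cocycles X"
proof -
  have "coboundary X f = (\<lambda>p \<sigma>. 0)" "coboundary X g = (\<lambda>p \<sigma>. 0)"
    using assms by (auto simp: cocycles_def)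
  then show ?thesis
    by (simp add: cocycles_def coboundary_cup) (simp add: cochains_def cup_def)
qed

lemma cocycles_add: "f \<in> cocycles X \<Longrightarrow> g \<in> cocycles X \<Longrightarrow> (\<lambda>p \<sigma>. f p \<sigma> + g p \<sigma>) \<in> cocycles X"
  by (auto simp: cocycles_def cochains_def coboundary_add)

lemma cocycles_scale: "f \<in> cocycles X \<Longrightarrow> (\<lambda>p \<sigma>. r * f p \<sigma>) \<in> cocycles X"
  by (auto simp: cocycles_def cochains_def coboundary_scale)

lemma cocycles_uminus: "f \<in> cocycles X \<Longrightarrow> (\<lambda>p \<sigma>. - f p \<sigma>) \<in> cocycles X"
  by (auto simp: cocycles_def cochains_def coboundary_uminus)

lemma cocycles_zero: "(\<lambda>p \<sigma>. 0) \<in> cocycles X"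
  by (simp add: cocycles_def cochains_def coboundary_zero)

lemma cocycles_cochains: "f \<in> cocycles X \<Longrightarrow> f \<in> cochains X"
  by (simp add: cocycles_def)

lemma cocycle_ring_simps [simp]:
  "carrier (cocycle_ring X) = cocycles X"
  "\<zero>\<^bsub>cocycle_ring X\<^esub> = (\<lambda>p \<sigma>. 0)"
  "\<one>\<^bsub>cocycle_ring X\<^esub> = const_cochain X 1"
  "f \<oplus>\<^bsub>cocycle_ring X\<^esub> g = (\<lambda>p \<sigma>. f p \<sigma> + g p \<sigma>)"
  "f \<otimes>\<^bsub>cocycle_ring X\<^esub> g = cup X f g"
  by (simp_all add: cocycle_ring_def)

lemma ring_cocycle_ring: "ring (cocycle_ring X)"
proof (rule ringI)
  show "abelian_group (cocycle_ring X)"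
  proof (rule abelian_groupI, goal_cases)
    case (6 f)
    then show ?case
      by (intro bexI[of _ "\<lambda>p \<sigma>. - f p \<sigma>"]) (auto intro: cocycles_uminus)
  qed (auto intro: cocycles_add cocycles_zero simp: add_ac)
  show "Group.monoid (cocycle_ring X)"
    by (rule monoidI)
      (auto intro: cup_cocycles const_cochain_cocycle simp: cup_assoc cup_one_right cup_const_left cocycles_cochains)
qed (auto simp: cup_add_left cup_add_right)

lemma coboundaries_subset: "coboundaries X \<subseteq> cocycles X"
  by (auto simp: coboundaries_def cocycles_def coboundary_coboundary) (auto simp: cochains_def coboundary_def)

lemma cocycle_ring_uminus: "f \<in> cocycles X \<Longrightarrow> \<ominus>\<^bsub>cocycle_ring X\<^esub> f = (\<lambda>p \<sigma>. - f p \<sigma>)"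
proof -
  interpret ring "cocycle_ring X" by (rule ring_cocycle_ring)
  assume "f \<in> cocycles X"
  then show ?thesis
    by (intro minus_equality) (auto intro: cocycles_uminus)
qed

text \<open>
  By the Leibniz rule \<open>(\<delta>h) g = \<delta>(h g)\<close> and, up to sign, \<open>g (\<delta>h) = \<delta>(g h)\<close> for a cocycle \<open>g\<close>.
\<close>
lemma ideal_coboundaries:
  fixes X :: "'a topology"
  shows "ideal (coboundaries X) (cocycle_ring X :: ('a, 'r::comm_ring_1) cochain ring)" (is "ideal ?I ?R")
proof (rule idealI)
  interpret ring ?R by (rule ring_cocycle_ring)
  show "ring ?R" by (rule ring_cocycle_ring)
  show "subgroup (?I) (add_monoid ?R)"
  proof (rule add.subgroupI)
    show "?I \<subseteq> carrier ?R"
      by (simp add: coboundaries_subset)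
    show "?I \<noteq> {}"
      by (auto simp: coboundaries_def cochains_def)
  next
    fix f :: "('a, 'r) cochain" assume f: "f \<in> ?I"
    then obtain h where h: "h \<in> cochains X" "f = coboundary X h" by (auto simp: coboundaries_def)
    have "(\<lambda>p \<sigma>. - f p \<sigma>) \<in> ?I"
      using h unfolding coboundaries_def
      by (intro image_eqI[of _ _ "\<lambda>p \<sigma>. - h p \<sigma>"]) (auto simp: coboundary_uminus cochains_def)
    then show "\<ominus>\<^bsub>?R\<^esub> f \<in> ?I"
      using f coboundaries_subset by (subst cocycle_ring_uminus) auto
  next
    fix f g :: "('a, 'r) cochain" assume "f \<in> ?I" "g \<in> ?I"
    then obtain h k where h: "h \<in> cochains X" "f = coboundary X h" "k \<in> cochains X" "g = coboundary X k"
      by (auto simp: coboundaries_def)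
    then show "f \<oplus>\<^bsub>?R\<^esub> g \<in> ?I"
      unfolding coboundaries_def
      by (intro image_eqI[of _ _ "\<lambda>p \<sigma>. h p \<sigma> + k p \<sigma>"]) (auto simp: coboundary_add cochains_def)
  qed
next
  fix f g :: "('a, 'r) cochain" assume "f \<in> ?I" "g \<in> carrier ?R"
  then obtain h where h: "h \<in> cochains X" "f = coboundary X h" and g: "coboundary X g = (\<lambda>p \<sigma>. 0)"
    by (auto simp: coboundaries_def cocycles_def)
  have "cup X f g = coboundary X (cup X h g)"
    by (simp add: coboundary_cup g h)
  then show "f \<otimes>\<^bsub>?R\<^esub> g \<in> ?I"
    by (auto simp: coboundaries_def cochains_def cup_def)
  have "coboundary X (grade_sign g) = (\<lambda>p \<sigma>. 0)"
    by (simp add: coboundary_grade_sign g) (simp add: grade_sign_def)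
  then have "cup X g f = coboundary X (cup X (grade_sign g) h)"
    by (simp add: coboundary_cup h)
  then show "g \<otimes>\<^bsub>?R\<^esub> f \<in> ?I"
    by (auto simp: coboundaries_def cochains_def cup_def)
qed

section \<open>The cohomology ring\<close>

lemma ring_hom_cohom_class: "ring_hom_ring (cocycle_ring X) (cohomology_ring X) (cohom_class X)"
  using ideal.rcos_ring_hom_ring[OF ideal_coboundaries]
  unfolding cohom_class_def[abs_def] cohomology_ring_def .

lemma ring_cohomology_ring: "ring (cohomology_ring X)"
  using ring_hom_cohom_class ring_hom_ring.axioms(2) by blast

lemma mem_cohom_class_iff:
  "f \<in> cohom_class X g \<longleftrightarrow> (\<exists>h\<in>cochains X. f = (\<lambda>p \<sigma>. coboundary X h p \<sigma> + g p \<sigma>))"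
  by (auto simp: cohom_class_def a_r_coset_def' coboundaries_def)

lemma cohom_class_self: "f \<in> cohom_class X f"
  unfolding mem_cohom_class_iff
  by (intro bexI[of _ "\<lambda>p \<sigma>. 0"]) (auto simp: coboundary_zero cochains_def)

lemma rep_cohom_class:
  obtains h where "h \<in> cochains X" "rep (cohom_class X f) = (\<lambda>p \<sigma>. coboundary X h p \<sigma> + f p \<sigma>)"
proof -
  have "rep (cohom_class X f) \<in> cohom_class X f"
    unfolding rep_def by (rule someI[where x = f]) (rule cohom_class_self)
  with that show ?thesis by (auto simp: mem_cohom_class_iff)
qed

lemma coboundary_cocycle: "h \<in> cochains X \<Longrightarrow> coboundary X h \<in> cocycles X"
  using coboundaries_subset by (auto simp: coboundaries_def)

lemma cohom_class_eq_zero_iff: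
  assumes "f \<in> cocycles X"
  shows "cohom_class X f = \<zero>\<^bsub>cohomology_ring X\<^esub> \<longleftrightarrow> f \<in> coboundaries X"
proof -
  interpret I: ideal "coboundaries X" "cocycle_ring X" by (rule ideal_coboundaries)
  have z: "\<zero>\<^bsub>cohomology_ring X\<^esub> = coboundaries X"
    by (simp add: cohomology_ring_def FactRing_def)
  show ?thesis
    using assms cohom_class_self[of f X] I.a_rcos_const[of f] unfolding z by (auto simp: cohom_class_def)
qed

lemma cohom_class_closed:
  assumes "f \<in> cocycles X"
  shows "cohom_class X f \<in> carrier (cohomology_ring X)"
proof -
  interpret ring_hom_ring "cocycle_ring X" "cohomology_ring X" "cohom_class X"
    by (rule ring_hom_cohom_class)
  show ?thesis using assms hom_closed[of f] by simp
qed

lemma cohom_class_add: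
  assumes "f \<in> cocycles X" "g \<in> cocycles X"
  shows "cohom_class X (\<lambda>p \<sigma>. f p \<sigma> + g p \<sigma>) = cohom_class X f \<oplus>\<^bsub>cohomology_ring X\<^esub> cohom_class X g"
proof -
  interpret ring_hom_ring "cocycle_ring X" "cohomology_ring X" "cohom_class X"
    by (rule ring_hom_cohom_class)
  show ?thesis using assms hom_add[of f g] by simp
qed

lemma cohom_class_cup:
  assumes "f \<in> cocycles X" "g \<in> cocycles X"
  shows "cohom_class X (cup X f g) = cohom_class X f \<otimes>\<^bsub>cohomology_ring X\<^esub> cohom_class X g"
proof -
  interpret ring_hom_ring "cocycle_ring X" "cohomology_ring X" "cohom_class X"
    by (rule ring_hom_cohom_class)
  show ?thesis using assms hom_mult[of f g] by simp
qed

lemma cohom_class_absorb: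
  assumes "f \<in> cocycles X" "h \<in> cochains X"
  shows "cohom_class X (\<lambda>p \<sigma>. coboundary X h p \<sigma> + f p \<sigma>) = cohom_class X f"
proof -
  interpret ring "cohomology_ring X" by (rule ring_cohomology_ring)
  have "cohom_class X (coboundary X h) = \<zero>\<^bsub>cohomology_ring X\<^esub>"
    using assms by (subst cohom_class_eq_zero_iff) (auto simp: coboundary_cocycle coboundaries_def)
  then show ?thesis
    using assms by (simp add: cohom_class_add coboundary_cocycle cohom_class_closed)
qed

lemma cohomology_ring_cases:
  assumes "x \<in> carrier (cohomology_ring X)"
  obtains f where "f \<in> cocycles X" "x = cohom_class X f"
  using assms that by (auto simp: cohomology_ring_def FactRing_def A_RCOSETS_def' cohom_class_def)

text \<open>
  The cochain whose component of degree \<open>2 l\<close> is that of \<open>g l\<close>; it represents the formal sum of the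
  classes of the \<open>g l\<close>.
\<close>
definition even_part :: "(nat \<Rightarrow> ('a, 'r::comm_ring_1) cochain) \<Rightarrow> ('a, 'r) cochain" where
  "even_part g = (\<lambda>p \<sigma>. if even p then g (p div 2) p \<sigma> else 0)"

lemma even_part_cocycle:
  assumes "\<And>l. g l \<in> cocycles X"
  shows "even_part g \<in> cocycles X"
proof -
  have "coboundary X (even_part g) p \<sigma> = 0" for p \<sigma>
  proof (cases "odd p")
    case True
    then have "coboundary X (even_part g) p \<sigma> = coboundary X (g ((p - 1) div 2)) p \<sigma>"
      by (simp add: coboundary_def even_part_def)
    then show ?thesis
      using assms[of "(p - 1) div 2"] by (simp add: cocycles_def)
  next
    case False
    then show ?thesis by (cases p) (auto simp: coboundary_def even_part_def)
  qed
  moreover have "even_part g \<in> cochains X"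
    using assms by (auto simp: even_part_def cocycles_def cochains_def)
  ultimately show ?thesis by (simp add: cocycles_def fun_eq_iff)
qed

text \<open>
  Changing each \<open>g l\<close> by the coboundary of \<open>h l\<close> changes the formal sum by the coboundary of the cochain
  assembled from the components of degree \<open>2 l - 1\<close> of the \<open>h l\<close>, so representatives may be chosen freely.
\<close>
lemma even_series_classes:
  assumes "\<And>l. g l \<in> cocycles X"
  shows "even_series X (\<lambda>l. cohom_class X (g l)) = cohom_class X (even_part g)"
proof -
  have "\<forall>l. \<exists>h. h \<in> cochains X \<and> rep (cohom_class X (g l)) = (\<lambda>p \<sigma>. coboundary X h p \<sigma> + g l p \<sigma>)"
    using rep_cohom_class by metis
  then obtain h where h: "\<And>l. h l \<in> cochains X"
    and r: "\<And>l. rep (cohom_class X (g l)) = (\<lambda>p \<sigma>. coboundary X (h l) p \<sigma> + g l p \<sigma>)"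
    by metis
  \<comment> \<open>the component of \<open>h l\<close> that matters has degree \<open>2 l - 1\<close>\<close>
  define k where "k = (\<lambda>q \<sigma>. if odd q then h (Suc q div 2) q \<sigma> else 0)"
  have "k \<in> cochains X"
    using h by (auto simp: k_def cochains_def)
  moreover have "(if even p then rep (cohom_class X (g (p div 2))) p \<sigma> else 0) =
      coboundary X k p \<sigma> + even_part g p \<sigma>" for p \<sigma>
    by (cases p) (auto simp: r coboundary_def even_part_def k_def)
  ultimately show ?thesis
    using assms by (simp add: even_series_def cohom_class_absorb even_part_cocycle)
qed

lemma coboundary_of_int:
  "coboundary X (\<lambda>p \<sigma>. of_int (f p \<sigma>)) = (\<lambda>p \<sigma>. of_int (coboundary X f p \<sigma>))"
  by (auto simp: coboundary_def fun_eq_iff simp del: sum.atMost_Suc)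

lemma cocycles_of_int: "f \<in> cocycles X \<Longrightarrow> (\<lambda>p \<sigma>. of_int (f p \<sigma>)) \<in> cocycles X"
  by (auto simp: cocycles_def cochains_def coboundary_of_int)

lemma rationalize_class:
  assumes "f \<in> cocycles X"
  shows "rationalize X (cohom_class X f) = cohom_class X (\<lambda>p \<sigma>. of_int (f p \<sigma>))"
proof -
  obtain h where h: "h \<in> cochains X" "rep (cohom_class X f) = (\<lambda>p \<sigma>. coboundary X h p \<sigma> + f p \<sigma>)"
    by (rule rep_cohom_class)
  have "(\<lambda>p \<sigma>. of_int (rep (cohom_class X f) p \<sigma>) :: rat) =
      (\<lambda>p \<sigma>. coboundary X (\<lambda>p \<sigma>. of_int (h p \<sigma>)) p \<sigma> + of_int (f p \<sigma>))"
    by (simp add: h(2) coboundary_of_int)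
  moreover have "(\<lambda>p \<sigma>. of_int (h p \<sigma>) :: rat) \<in> cochains X"
    using h(1) by (auto simp: cochains_def)
  ultimately show ?thesis
    using cocycles_of_int[OF assms, where 'b = rat] by (simp add: rationalize_def cohom_class_absorb)
qed

lemma rationalize_closed:
  "x \<in> carrier (cohomology_ring X) \<Longrightarrow> rationalize X x \<in> carrier (cohomology_ring X)"
  by (metis cohomology_ring_cases rationalize_class cohom_class_closed cocycles_of_int)

lemma cohom_exp_class:
  assumes "c \<in> cocycles X"
  shows "cohom_exp X (cohom_class X c) = cohom_class X
    (even_part (\<lambda>l. cup X (const_cochain X (1 / fact l)) (c [^]\<^bsub>cocycle_ring X\<^esub> l)))"
proof -
  interpret h: ring_hom_ring "cocycle_ring X" "cohomology_ring X" "cohom_class X"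
    by (rule ring_hom_cohom_class)
  have p: "c [^]\<^bsub>cocycle_ring X\<^esub> (l::nat) \<in> cocycles X" for l
    using h.R.nat_pow_closed[of c l] assms by simp
  have "cohom_class X (const_cochain X (1 / fact l)) \<otimes>\<^bsub>cohomology_ring X\<^esub>
      cohom_class X c [^]\<^bsub>cohomology_ring X\<^esub> l =
      cohom_class X (cup X (const_cochain X (1 / fact l)) (c [^]\<^bsub>cocycle_ring X\<^esub> l))" for l :: nat
    using p assms h.hom_nat_pow[of c l] by (simp add: cohom_class_cup const_cochain_cocycle)
  then show ?thesis
    using p by (simp add: cohom_exp_def even_series_classes cup_cocycles const_cochain_cocycle)
qed

text \<open>
  A cycle pairs to zero with every coboundary, so any representative of the class can be used.
\<close>
lemma kronecker_class:
  assumes "singular_relcycle p X {} (rep \<mu>)"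
  shows "kronecker p (cohom_class X f) \<mu> = chain_pairing (f p) (rep \<mu>)"
proof -
  obtain h where h: "h \<in> cochains X" "rep (cohom_class X f) = (\<lambda>p \<sigma>. coboundary X h p \<sigma> + f p \<sigma>)"
    by (rule rep_cohom_class)
  have "singular_chain p X (rep \<mu>)" "chain_boundary p (rep \<mu>) = 0"
    using assms by (auto simp: singular_cycle)
  then have "chain_pairing (coboundary X h p) (rep \<mu>) = 0"
    using chain_pairing_coboundary[of p X "rep \<mu>" h] by simp
  moreover have "kronecker p (cohom_class X f) \<mu> = chain_pairing (rep (cohom_class X f) p) (rep \<mu>)"
    by (simp add: kronecker_def chain_pairing_def)
  ultimately show ?thesis
    by (simp add: h(2) chain_pairing_fun_add)
qed

lemma rep_homology_cycle:
  assumes "\<mu> \<in> carrier (homology_group (int p) X)"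
  shows "singular_relcycle p X {} (rep \<mu>)"
proof -
  obtain c where c: "singular_relcycle p X {} c" "\<mu> = homologous_rel_set p X {} c"
    using assms by (auto simp: carrier_relative_homology_group)
  have "rep \<mu> \<in> \<mu>"
    unfolding rep_def by (rule someI[of _ c]) (simp add: c(2))
  then show ?thesis
    using c homologous_rel_singular_relcycle by (metis mem_Collect_eq)
qed

lemma fundamental_class_closed:
  "fundamental_class n X A J \<in> carrier (homology_group (int (2 * n)) X)"
proof (cases "\<exists>!\<mu>. is_fundamental_class n X A J \<mu>")
  case True
  then have "is_fundamental_class n X A J (fundamental_class n X A J)"
    by (simp add: fundamental_class_def theI')
  then show ?thesis by (simp add: is_fundamental_class_def)
next
  case False
  then have "fundamental_class n X A J = \<one>\<^bsub>homology_group (int (2 * n)) X\<^esub>"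
    by (simp only: fundamental_class_def if_False)
  then show ?thesis
    by (simp only: group.is_monoid[OF group_relative_homology_group] monoid.one_closed)
qed

lemma cohomology_subset: "cohomology p X \<subseteq> carrier (cohomology_ring X)"
  by (auto simp: cohomology_def cohom_class_closed)

lemma chern_class_closed: "chern_class n E i \<in> carrier (cohomology_ring (Base E))"
proof (cases "\<exists>!c. is_chern_classes n E c")
  case True
  then have "is_chern_classes n E (chern_class n E)"
    by (simp add: chern_class_def theI')
  then show ?thesis
    using cohomology_subset by (auto simp: is_chern_classes_def)
next
  case False
  interpret ring "cohomology_ring (Base E) :: ('a, int) cohom ring" by (rule ring_cohomology_ring)
  show ?thesis using False by (simp add: chern_class_def)
qed

lemma cohom_eval_closed:
  assumes "\<And>i. a i \<in> carrier (cohomology_ring X)"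
  shows "cohom_eval X n a P \<in> carrier (cohomology_ring X)"
proof -
  interpret ring "cohomology_ring X :: ('a, rat) cohom ring" by (rule ring_cohomology_ring)
  have "foldr (\<lambda>i y. a i [^]\<^bsub>cohomology_ring X\<^esub> Poly_Mapping.lookup m i \<otimes>\<^bsub>cohomology_ring X\<^esub> y)
      is \<one>\<^bsub>cohomology_ring X\<^esub> \<in> carrier (cohomology_ring X)" for m :: "nat \<Rightarrow>\<^sub>0 nat" and "is"
    using assms by (induction "is") auto
  then show ?thesis
    by (auto simp: cohom_eval_def Let_def const_cochain_cocycle cohom_class_closed intro!: finsum_closed)
qed

text \<open>
  The Todd class enters the index as a factor that is the same for all line bundles; this provides a
  fixed cocycle for it.
\<close>
lemma todd_class_cocycle:
  obtains t where "t \<in> cocycles (Base E)" "todd_class n E = cohom_class (Base E) t"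
proof -
  have "\<forall>k. \<exists>g. g \<in> cocycles (Base E) \<and> cohom_eval (Base E) n
     (\<lambda>i. rationalize (Base E) (chern_class n E i)) (todd_polynomial n k) = cohom_class (Base E) g"
    by (meson cohomology_ring_cases cohom_eval_closed rationalize_closed chern_class_closed)
  then obtain g where "\<And>k. g k \<in> cocycles (Base E)" "\<And>k. cohom_eval (Base E) n
     (\<lambda>i. rationalize (Base E) (chern_class n E i)) (todd_polynomial n k) = cohom_class (Base E) (g k)"
    by metis
  then show ?thesis
    by (intro that[of "even_part g"]) (auto simp: todd_class_def even_series_classes even_part_cocycle)
qed

section \<open>Polynomial functions on integer points\<close>

definition int_eval :: "(nat \<Rightarrow> int) \<Rightarrow> mpoly_rat \<Rightarrow> rat" where
  "int_eval k P = mpoly_eval (\<lambda>r. r) (\<lambda>i. of_int (k i)) P"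

definition monom_value :: "(nat \<Rightarrow> int) \<Rightarrow> (nat \<Rightarrow>\<^sub>0 nat) \<Rightarrow> rat" where
  "monom_value k m = (\<Prod>i\<in>Poly_Mapping.keys m. of_int (k i) ^ Poly_Mapping.lookup m i)"

lemma monom_value_superset:
  assumes "finite S" "Poly_Mapping.keys m \<subseteq> S"
  shows "monom_value k m = (\<Prod>i\<in>S. of_int (k i) ^ Poly_Mapping.lookup m i)"
  unfolding monom_value_def using assms by (intro prod.mono_neutral_left) (auto simp: in_keys_iff)

lemma monom_degree_superset:
  assumes "finite S" "Poly_Mapping.keys m \<subseteq> S"
  shows "monom_degree m = (\<Sum>i\<in>S. Poly_Mapping.lookup m i)"
  unfolding monom_degree_def using assms by (intro sum.mono_neutral_left) (auto simp: in_keys_iff)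

lemma int_eval_superset:
  assumes "finite S" "Poly_Mapping.keys P \<subseteq> S"
  shows "int_eval k P = (\<Sum>m\<in>S. Poly_Mapping.lookup P m * monom_value k m)"
  unfolding int_eval_def mpoly_eval_def monom_value_def using assms
  by (intro sum.mono_neutral_left) (auto simp: in_keys_iff)

lemma int_eval_eq: "int_eval k P = (\<Sum>m\<in>Poly_Mapping.keys P. Poly_Mapping.lookup P m * monom_value k m)"
  by (rule int_eval_superset) auto

lemma monom_value_add: "monom_value k (m + m') = monom_value k m * monom_value k m'"
  and monom_degree_add: "monom_degree (m + m') = monom_degree m + monom_degree m'"
proof -
  let ?S = "Poly_Mapping.keys m \<union> Poly_Mapping.keys m'"
  have S: "finite ?S" "Poly_Mapping.keys (m + m') \<subseteq> ?S" "Poly_Mapping.keys m \<subseteq> ?S" "Poly_Mapping.keys m' \<subseteq> ?S"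
    using keys_add[of m m'] by auto
  show "monom_value k (m + m') = monom_value k m * monom_value k m'"
    by (simp add: monom_value_superset[OF S(1,2)] monom_value_superset[OF S(1,3)]
        monom_value_superset[OF S(1,4)] lookup_add power_add prod.distrib)
  show "monom_degree (m + m') = monom_degree m + monom_degree m'"
    by (simp add: monom_degree_superset[OF S(1,2)] monom_degree_superset[OF S(1,3)]
        monom_degree_superset[OF S(1,4)] lookup_add sum.distrib)
qed

lemma mpoly_degree_le_iff: "mpoly_degree P \<le> d \<longleftrightarrow> (\<forall>m\<in>Poly_Mapping.keys P. monom_degree m \<le> d)"
  by (simp add: mpoly_degree_def)

lemma mpoly_vars_subset_iff: "mpoly_vars P \<subseteq> V \<longleftrightarrow> (\<forall>m\<in>Poly_Mapping.keys P. Poly_Mapping.keys m \<subseteq> V)"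
  by (auto simp: mpoly_vars_def)

lemma int_eval_cong:
  assumes "mpoly_vars P \<subseteq> V" "\<And>i. i \<in> V \<Longrightarrow> k i = k' i"
  shows "int_eval k P = int_eval k' P"
proof -
  have "monom_value k m = monom_value k' m" if "m \<in> Poly_Mapping.keys P" for m
    unfolding monom_value_def
  proof (rule prod.cong)
    fix i assume "i \<in> Poly_Mapping.keys m"
    then have "i \<in> V" using assms(1) that by (auto simp: mpoly_vars_def)
    then show "of_int (k i) ^ Poly_Mapping.lookup m i = of_int (k' i) ^ Poly_Mapping.lookup m i"
      using assms(2) by simp
  qed simp
  then show ?thesis by (simp add: int_eval_eq)
qed

text \<open>
  Functions on integer points that some polynomial in the variables \<open>1, \<dots>, b\<close> of degree at most \<open>d\<close>
  represents. Degrees are only bounded, which makes the predicate stable under sums, products and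
  substitutions without any discussion of cancellation.
\<close>
definition poly_fun :: "nat \<Rightarrow> nat \<Rightarrow> ((nat \<Rightarrow> int) \<Rightarrow> rat) \<Rightarrow> bool" where
  "poly_fun b d f \<longleftrightarrow> (\<exists>P. mpoly_vars P \<subseteq> {1..b} \<and> mpoly_degree P \<le> d \<and> (\<forall>k. f k = int_eval k P))"

lemma poly_fun_mono: "poly_fun b d f \<Longrightarrow> d \<le> d' \<Longrightarrow> poly_fun b d' f"
  unfolding poly_fun_def using le_trans by blast

lemma poly_fun_monom:
  assumes "Poly_Mapping.keys m \<subseteq> {1..b}" "monom_degree m \<le> d"
  shows "poly_fun b d (\<lambda>k. c * monom_value k m)"
  unfolding poly_fun_def using assms
  by (intro exI[of _ "Poly_Mapping.single m c"])
    (auto simp: mpoly_vars_subset_iff mpoly_degree_le_iff int_eval_eq split: if_splits)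

lemma poly_fun_const: "poly_fun b d (\<lambda>k. c)"
  using poly_fun_monom[of 0 b d c] by (simp add: monom_degree_def monom_value_def)

lemma poly_fun_var: "i \<in> {1..b} \<Longrightarrow> poly_fun b 1 (\<lambda>k. of_int (k i))"
  using poly_fun_monom[of "Poly_Mapping.single i 1" b 1 1] by (simp add: monom_degree_def monom_value_def)

lemma poly_fun_add:
  assumes "poly_fun b d f" "poly_fun b d g"
  shows "poly_fun b d (\<lambda>k. f k + g k)"
proof -
  obtain P Q where P: "mpoly_vars P \<subseteq> {1..b}" "mpoly_degree P \<le> d" "\<And>k. f k = int_eval k P"
    and Q: "mpoly_vars Q \<subseteq> {1..b}" "mpoly_degree Q \<le> d" "\<And>k. g k = int_eval k Q"
    using assms by (auto simp: poly_fun_def)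
  let ?S = "Poly_Mapping.keys P \<union> Poly_Mapping.keys Q"
  have S: "finite ?S" "Poly_Mapping.keys (P + Q) \<subseteq> ?S" "Poly_Mapping.keys P \<subseteq> ?S" "Poly_Mapping.keys Q \<subseteq> ?S"
    using keys_add[of P Q] by auto
  have "int_eval k (P + Q) = f k + g k" for k
    unfolding P(3) Q(3) int_eval_superset[OF S(1,2)] int_eval_superset[OF S(1,3)] int_eval_superset[OF S(1,4)]
    by (simp add: lookup_add distrib_right sum.distrib)
  moreover have "mpoly_vars (P + Q) \<subseteq> {1..b}" "mpoly_degree (P + Q) \<le> d"
    using P(1,2) Q(1,2) S(2) unfolding mpoly_vars_subset_iff mpoly_degree_le_iff by blast+
  ultimately show ?thesis unfolding poly_fun_def by metis
qed

lemma poly_fun_sum: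
  "(\<And>i. i \<in> I \<Longrightarrow> poly_fun b d (f i)) \<Longrightarrow> poly_fun b d (\<lambda>k. \<Sum>i\<in>I. f i k)"
  by (induction I rule: infinite_finite_induct) (auto intro: poly_fun_const poly_fun_add)

lemma poly_fun_mult:
  assumes "poly_fun b d f" "poly_fun b d' g"
  shows "poly_fun b (d + d') (\<lambda>k. f k * g k)"
proof -
  obtain P Q where P: "mpoly_vars P \<subseteq> {1..b}" "mpoly_degree P \<le> d" "\<And>k. f k = int_eval k P"
    and Q: "mpoly_vars Q \<subseteq> {1..b}" "mpoly_degree Q \<le> d'" "\<And>k. g k = int_eval k Q"
    using assms by (auto simp: poly_fun_def)
  have "f k * g k = (\<Sum>m\<in>Poly_Mapping.keys P. \<Sum>m'\<in>Poly_Mapping.keys Q.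
      (Poly_Mapping.lookup P m * Poly_Mapping.lookup Q m') * monom_value k (m + m'))" for k
    by (simp add: P(3) Q(3) int_eval_eq sum_product monom_value_add mult_ac)
  moreover have "poly_fun b (d + d') (\<lambda>k. \<Sum>m\<in>Poly_Mapping.keys P. \<Sum>m'\<in>Poly_Mapping.keys Q.
      (Poly_Mapping.lookup P m * Poly_Mapping.lookup Q m') * monom_value k (m + m'))"
  proof (intro poly_fun_sum poly_fun_monom)
    fix m m' assume "m \<in> Poly_Mapping.keys P" "m' \<in> Poly_Mapping.keys Q"
    then show "Poly_Mapping.keys (m + m') \<subseteq> {1..b}" "monom_degree (m + m') \<le> d + d'"
      using P(1,2) Q(1,2) keys_add[of m m'] unfolding mpoly_vars_subset_iff mpoly_degree_le_iff
      by (blast, simp add: monom_degree_add add_mono)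
  qed
  ultimately show ?thesis by simp
qed

lemma poly_fun_power: "poly_fun b d f \<Longrightarrow> poly_fun b (n * d) (\<lambda>k. f k ^ n)"
  by (induction n) (auto intro: poly_fun_const poly_fun_mult)

lemma poly_fun_prod:
  "(\<And>i. i \<in> I \<Longrightarrow> poly_fun b (d i) (f i)) \<Longrightarrow> poly_fun b (\<Sum>i\<in>I. d i) (\<lambda>k. \<Prod>i\<in>I. f i k)"
  by (induction I rule: infinite_finite_induct) (auto intro: poly_fun_const poly_fun_mult)

lemma poly_fun_linear: "poly_fun b 1 (\<lambda>k. \<Sum>i=1..b. of_int (k i) * a i)"
  using poly_fun_mult[OF poly_fun_var poly_fun_const[of _ 0]] by (intro poly_fun_sum) simp

lemma poly_fun_substitute:
  assumes f: "poly_fun b d f" and s: "\<And>j. j \<in> {1..b} \<Longrightarrow> poly_fun b' 1 (\<lambda>k. of_int (s k j))"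
  shows "poly_fun b' d (\<lambda>k. f (s k))"
proof -
  obtain P where P: "mpoly_vars P \<subseteq> {1..b}" "mpoly_degree P \<le> d" "\<And>k. f k = int_eval k P"
    using f by (auto simp: poly_fun_def)
  have "poly_fun b' d (\<lambda>k. Poly_Mapping.lookup P m * monom_value (s k) m)" if "m \<in> Poly_Mapping.keys P" for m
  proof -
    have m: "Poly_Mapping.keys m \<subseteq> {1..b}" "monom_degree m \<le> d"
      using P(1,2) that by (auto simp: mpoly_vars_subset_iff mpoly_degree_le_iff)
    have "poly_fun b' (\<Sum>i\<in>Poly_Mapping.keys m. Poly_Mapping.lookup m i * 1) (\<lambda>k. monom_value (s k) m)"
      unfolding monom_value_def using m(1) s by (intro poly_fun_prod poly_fun_power) auto
    then have "poly_fun b' d (\<lambda>k. monom_value (s k) m)"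
      using m(2) by (auto simp: monom_degree_def intro: poly_fun_mono)
    then show ?thesis
      using poly_fun_mult[OF poly_fun_const[of b' 0]] by fastforce
  qed
  then show ?thesis
    unfolding P(3) int_eval_eq by (rule poly_fun_sum)
qed

text \<open>
  The backward difference of order \<open>e\<close> lowers degrees by \<open>e\<close>. The induction on the exponent splits
  off one factor \<open>x - j\<close> and absorbs \<open>j\<close> into the binomial coefficient by
  \<open>j (e choose j) = e (e - 1 choose j - 1)\<close>.
\<close>
lemma alternating_binomial_power_sum:
  fixes x :: rat
  assumes "r \<le> e"
  shows "(\<Sum>j\<le>e. (-1) ^ j * of_nat (e choose j) * (x - of_nat j) ^ r) = (if r = e then fact e else 0)"
  using assms
proof (induction r arbitrary: e x)
  case 0
  then show ?case
    using choose_alternating_sum[of e, where 'a = rat] by (cases "e = 0") auto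
next
  case (Suc r)
  then obtain d where e: "e = Suc d" by (cases e) auto
  define S where "S e r x = (\<Sum>j\<le>e. (-1) ^ j * of_nat (e choose j) * (x - of_nat j) ^ r)" for e r and x :: rat
  have "(\<Sum>j\<le>e. (-1) ^ j * of_nat (j * (e choose j)) * (x - of_nat j) ^ r) =
      (\<Sum>j\<le>d. (-1) ^ Suc j * of_nat (Suc j * (Suc d choose Suc j)) * (x - of_nat (Suc j)) ^ r)"
    unfolding e by (subst sum.atMost_Suc_shift) simp
  also have "\<dots> = - of_nat e * S d r (x - 1)"
    unfolding Suc_times_binomial e S_def sum_distrib_left
    by (intro sum.cong refl) (simp add: algebra_simps)
  finally have absorb: "(\<Sum>j\<le>e. (-1) ^ j * of_nat (j * (e choose j)) * (x - of_nat j) ^ r) =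
      - of_nat e * S d r (x - 1)" .
  have "S e (Suc r) x = x * S e r x -
      (\<Sum>j\<le>e. (-1) ^ j * of_nat (j * (e choose j)) * (x - of_nat j) ^ r)"
    unfolding S_def sum_distrib_left sum_subtractf[symmetric]
    by (intro sum.cong refl) (simp add: algebra_simps)
  also have "\<dots> = x * S e r x + of_nat e * S d r (x - 1)"
    by (simp only: absorb mult_minus_left diff_minus_eq_add)
  also have "S e r x = 0"
    using Suc.IH[of e x] Suc.prems by (simp add: S_def)
  also have "S d r (x - 1) = (if r = d then fact d else 0)"
    using Suc.IH[of d "x - 1"] Suc.prems e by (simp add: S_def)
  finally show ?case
    by (simp add: S_def e)
qed

text \<open>
  On a monomial the sum over the grid factors into one alternating sum for each variable. A monomial
  \<open>m \<noteq> u\<close> whose degree is at most that of \<open>u\<close> has a smaller exponent than \<open>u\<close> in some variable, and the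
  corresponding factor vanishes. The grid consists of the points \<open>- 1 - j\<close> because those are the points at
  which \<open>degree_lower_bound\<close> knows the values.
\<close>
theorem coefficient_formula:
  assumes "mpoly_vars P \<subseteq> {1..b}" "Poly_Mapping.keys u \<subseteq> {1..b}" "mpoly_degree P \<le> monom_degree u"
  shows "(\<Sum>j\<in>(\<Pi>\<^sub>E i\<in>{1..b}. {..Poly_Mapping.lookup u i}).
      (\<Prod>i=1..b. (-1) ^ j i * of_nat (Poly_Mapping.lookup u i choose j i)) * int_eval (\<lambda>i. - 1 - int (j i)) P) =
    Poly_Mapping.lookup P u * (\<Prod>i=1..b. fact (Poly_Mapping.lookup u i))"
proof -
  define w where "w i j = (-1) ^ j * (of_nat (Poly_Mapping.lookup u i choose j) :: rat)" for i j
  define J where "J = (\<Pi>\<^sub>E i\<in>{1..b}. {..Poly_Mapping.lookup u i})"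
  have mon: "(\<Sum>j\<in>J. (\<Prod>i=1..b. w i (j i)) * monom_value (\<lambda>i. - 1 - int (j i)) m) =
      (if m = u then \<Prod>i=1..b. fact (Poly_Mapping.lookup u i) else 0)"
    if "m \<in> Poly_Mapping.keys P" for m
  proof -
    have m: "Poly_Mapping.keys m \<subseteq> {1..b}" "monom_degree m \<le> monom_degree u"
      using assms(1,3) that by (auto simp: mpoly_vars_subset_iff mpoly_degree_le_iff)
    have "(\<Sum>j\<in>J. (\<Prod>i=1..b. w i (j i)) * monom_value (\<lambda>i. - 1 - int (j i)) m) =
        (\<Sum>j\<in>J. \<Prod>i=1..b. w i (j i) * (- 1 - of_nat (j i)) ^ Poly_Mapping.lookup m i)"
      by (simp add: monom_value_superset[OF _ m(1)] prod.distrib)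
    also have "\<dots> = (\<Prod>i=1..b. \<Sum>j\<le>Poly_Mapping.lookup u i. w i j * (- 1 - of_nat j) ^ Poly_Mapping.lookup m i)"
      unfolding J_def by (rule prod_sum_PiE[symmetric]) auto
    also have "\<dots> = (if m = u then \<Prod>i=1..b. fact (Poly_Mapping.lookup u i) else 0)"
    proof (cases "m = u")
      case True
      then show ?thesis
        by (simp add: w_def alternating_binomial_power_sum)
    next
      case False
      have "\<exists>i\<in>{1..b}. Poly_Mapping.lookup m i < Poly_Mapping.lookup u i"
      proof (rule ccontr)
        assume "\<not> ?thesis"
        then have le: "Poly_Mapping.lookup u i \<le> Poly_Mapping.lookup m i" if "i \<in> {1..b}" for i
          using that by (meson not_le)
        have "(\<Sum>i=1..b. Poly_Mapping.lookup m i) \<le> (\<Sum>i=1..b. Poly_Mapping.lookup u i)"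
          using m(2) by (simp add: monom_degree_superset[OF _ m(1)] monom_degree_superset[OF _ assms(2)])
        then have "Poly_Mapping.lookup u i = Poly_Mapping.lookup m i" if "i \<in> {1..b}" for i
          using sum_mono_inv[of "Poly_Mapping.lookup u" "{1..b}" "Poly_Mapping.lookup m" i] le that sum_mono[of "{1..b}" "Poly_Mapping.lookup u" "Poly_Mapping.lookup m"]
          by fastforce
        moreover have "Poly_Mapping.lookup u i = Poly_Mapping.lookup m i" if "i \<notin> {1..b}" for i
          using that m(1) assms(2) by (metis in_keys_iff subsetD)
        ultimately have "m = u" by (metis poly_mapping_eqI)
        with False show False by simp
      qed
      then obtain i where i: "i \<in> {1..b}" "Poly_Mapping.lookup m i < Poly_Mapping.lookup u i" by blast
      then have "(\<Sum>j\<le>Poly_Mapping.lookup u i. w i j * (- 1 - of_nat j) ^ Poly_Mapping.lookup m i) = 0"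
        using alternating_binomial_power_sum[of "Poly_Mapping.lookup m i" "Poly_Mapping.lookup u i" "-1"]
        by (simp add: w_def)
      with i False show ?thesis
        by (simp only: if_False) (rule prod_zero, auto)
    qed
    finally show ?thesis .
  qed
  have "(\<Sum>j\<in>J. (\<Prod>i=1..b. w i (j i)) * int_eval (\<lambda>i. - 1 - int (j i)) P) =
      (\<Sum>m\<in>Poly_Mapping.keys P. Poly_Mapping.lookup P m *
        (\<Sum>j\<in>J. (\<Prod>i=1..b. w i (j i)) * monom_value (\<lambda>i. - 1 - int (j i)) m))"
    unfolding int_eval_eq sum_distrib_left by (subst sum.swap) (simp add: mult_ac)
  also have "\<dots> = (\<Sum>m\<in>Poly_Mapping.keys P. if m = u then
      Poly_Mapping.lookup P m * (\<Prod>i=1..b. fact (Poly_Mapping.lookup u i)) else 0)"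
    by (intro sum.cong refl) (simp only: mon if_distrib[of "(*) _"] mult_zero_right cong: if_cong)
  also have "\<dots> = Poly_Mapping.lookup P u * (\<Prod>i=1..b. fact (Poly_Mapping.lookup u i))"
    by (simp add: in_keys_iff)
  finally show ?thesis
    by (simp add: J_def w_def)
qed

text \<open>
  If the difference were nonzero, the coefficient formula at one of its monomials of maximal degree
  would express a nonzero coefficient through values that are all zero.
\<close>
lemma mpoly_eq_if_int_eval_eq:
  assumes "mpoly_vars P \<subseteq> {1..b}" "mpoly_vars Q \<subseteq> {1..b}" "\<And>k. int_eval k P = int_eval k Q"
  shows "P = Q"
proof (rule ccontr)
  assume "P \<noteq> Q"
  then have ne: "Poly_Mapping.keys (P - Q) \<noteq> {}" by simp
  let ?S = "Poly_Mapping.keys P \<union> Poly_Mapping.keys Q"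
  have S: "finite ?S" "Poly_Mapping.keys (P - Q) \<subseteq> ?S" "Poly_Mapping.keys P \<subseteq> ?S" "Poly_Mapping.keys Q \<subseteq> ?S"
    by (auto simp: in_keys_iff lookup_minus)
  have "int_eval k (P - Q) = int_eval k P - int_eval k Q" for k
    unfolding int_eval_superset[OF S(1,2)] int_eval_superset[OF S(1,3)] int_eval_superset[OF S(1,4)]
    by (simp add: lookup_minus left_diff_distrib sum_subtractf)
  then have zero: "int_eval k (P - Q) = 0" for k
    using assms(3) by simp
  have vars: "mpoly_vars (P - Q) \<subseteq> {1..b}"
    using assms(1,2) S(2) unfolding mpoly_vars_subset_iff by blast
  define d where "d = Max (monom_degree ` Poly_Mapping.keys (P - Q))"
  have "d \<in> monom_degree ` Poly_Mapping.keys (P - Q)"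
    unfolding d_def using ne by (intro Max_in) auto
  then obtain u where u: "u \<in> Poly_Mapping.keys (P - Q)" "monom_degree u = d" by auto
  have "mpoly_degree (P - Q) \<le> monom_degree u"
    unfolding mpoly_degree_le_iff u(2) d_def by (auto intro: Max_ge)
  then have "Poly_Mapping.lookup (P - Q) u * (\<Prod>i=1..b. fact (Poly_Mapping.lookup u i)) = 0"
    using coefficient_formula[OF vars, of u] u(1) vars by (simp add: zero mpoly_vars_subset_iff)
  then show False
    using u(1) by (simp add: in_keys_iff)
qed

text \<open>
  The mixed difference of order \<open>m i - 1\<close> in each variable \<open>i\<close> is a combination of the values at the
  points \<open>-k\<close> with \<open>0 < k i \<le> m i\<close>. It annihilates polynomials of degree less than \<open>\<Sum>i. (m i - 1)\<close>,
  but here it reduces to a nonzero multiple of the value at \<open>-m\<close>.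
\<close>
lemma degree_lower_bound:
  fixes m :: "nat \<Rightarrow> int"
  assumes F: "poly_fun b d F" and pos: "\<And>i. i \<in> {1..b} \<Longrightarrow> 0 < m i"
    and ne: "F (\<lambda>i. - m i) \<noteq> 0"
    and zero: "\<And>k. (\<And>i. i \<in> {1..b} \<Longrightarrow> 0 < k i \<and> k i \<le> m i) \<Longrightarrow>
       (\<Sum>i=1..b. k i) < (\<Sum>i=1..b. m i) \<Longrightarrow> F (\<lambda>i. - k i) = 0"
  shows "(\<Sum>i=1..b. (m i - 1)) \<le> int d"
proof (rule ccontr)
  assume less: "\<not> ?thesis"
  obtain Q where Q: "mpoly_vars Q \<subseteq> {1..b}" "mpoly_degree Q \<le> d" "\<And>k. F k = int_eval k Q"
    using F by (auto simp: poly_fun_def)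
  define e where "e i = nat (m i - 1)" for i
  define u where "u = (\<Sum>i=1..b. Poly_Mapping.single i (e i))"
  have u: "Poly_Mapping.lookup u i = (if i \<in> {1..b} then e i else 0)" for i
    by (simp add: u_def lookup_sum lookup_single when_def)
  have keys: "Poly_Mapping.keys u \<subseteq> {1..b}"
    by (auto simp: in_keys_iff u split: if_splits)
  have "int (monom_degree u) = (\<Sum>i=1..b. int (e i))"
    by (simp add: monom_degree_superset[OF _ keys] u)
  also have "\<dots> = (\<Sum>i=1..b. (m i - 1))"
    using pos by (intro sum.cong) (auto simp: e_def)
  finally have "d < monom_degree u" using less by simp
  then have "u \<notin> Poly_Mapping.keys Q" "mpoly_degree Q \<le> monom_degree u"
    using Q(2) by (auto simp: mpoly_degree_le_iff)
  define w where "w j = (\<Prod>i=1..b. (-1) ^ j i * (of_nat (e i choose j i) :: rat))" for j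
  define I where "I = (\<Pi>\<^sub>E i\<in>{1..b}. {..e i})"
  have I: "I = (\<Pi>\<^sub>E i\<in>{1..b}. {..Poly_Mapping.lookup u i})"
    unfolding I_def by (rule PiE_cong) (simp add: u)
  have "(\<Sum>j\<in>I. w j * F (\<lambda>i. - 1 - int (j i))) = 0"
    using coefficient_formula[OF Q(1) keys \<open>mpoly_degree Q \<le> monom_degree u\<close>] \<open>u \<notin> Poly_Mapping.keys Q\<close>
    by (simp add: I Q(3) w_def u in_keys_iff)
  moreover have "(\<Sum>j\<in>I. w j * F (\<lambda>i. - 1 - int (j i))) =
      (\<Sum>j\<in>{restrict e {1..b}}. w j * F (\<lambda>i. - 1 - int (j i)))"
  proof (rule sum.mono_neutral_right)
    show "\<forall>j\<in>I - {restrict e {1..b}}. w j * F (\<lambda>i. - 1 - int (j i)) = 0"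
    proof
      fix j assume j: "j \<in> I - {restrict e {1..b}}"
      have le: "j i \<le> e i" if "i \<in> {1..b}" for i
        using j that by (auto simp: I_def)
      have "\<exists>i\<in>{1..b}. j i \<noteq> e i"
      proof (rule ccontr)
        assume "\<not> ?thesis"
        then have "j = restrict e {1..b}"
          using j by (intro extensionalityI[of _ "{1..b}"]) (auto simp: I_def PiE_def)
        with j show False by simp
      qed
      then obtain i where "i \<in> {1..b}" "j i < e i"
        using le by (meson le_neq_implies_less)
      then have "(\<Sum>i=1..b. 1 + int (j i)) < (\<Sum>i=1..b. 1 + int (e i))"
        using le by (intro sum_strict_mono_ex1) auto
      also have "\<dots> = (\<Sum>i=1..b. m i)"
        using pos by (intro sum.cong) (auto simp: e_def)
      finally have "F (\<lambda>i. - (1 + int (j i))) = 0"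
      proof (intro zero)
        fix i assume i: "i \<in> {1..b}"
        show "0 < 1 + int (j i) \<and> 1 + int (j i) \<le> m i"
          using le[OF i] pos[OF i] by (simp add: e_def)
      qed
      then show "w j * F (\<lambda>i. - 1 - int (j i)) = 0" by (simp add: algebra_simps)
    qed
  qed (auto simp: I_def intro!: finite_PiE)
  moreover have "F (\<lambda>i. - 1 - int (restrict e {1..b} i)) = F (\<lambda>i. - m i)"
    unfolding Q(3) using Q(1) by (rule int_eval_cong) (use pos in \<open>auto simp: e_def\<close>)
  moreover have "w (restrict e {1..b}) \<noteq> 0"
    by (simp add: w_def)
  ultimately show False using ne by simp
qed

section \<open>Degree two cohomology modulo torsion\<close>

text \<open>
  Calculations in the cohomology group of degree 2 and in its quotient by torsion are carried out on
  these representatives.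
\<close>
definition degree2_cocycles :: "'a topology \<Rightarrow> ('a, int) cochain set" where
  "degree2_cocycles X = {f \<in> cocycles X. \<forall>q. q \<noteq> 2 \<longrightarrow> f q = (\<lambda>\<sigma>. 0)}"

lemma degree2_cocycles_cocycles: "f \<in> degree2_cocycles X \<Longrightarrow> f \<in> cocycles X"
  by (simp add: degree2_cocycles_def)

lemma degree2_cocycles_add:
  "f \<in> degree2_cocycles X \<Longrightarrow> g \<in> degree2_cocycles X \<Longrightarrow> (\<lambda>p \<sigma>. f p \<sigma> + g p \<sigma>) \<in> degree2_cocycles X"
  by (auto simp: degree2_cocycles_def cocycles_add)

lemma degree2_cocycles_scale: "f \<in> degree2_cocycles X \<Longrightarrow> (\<lambda>p \<sigma>. r * f p \<sigma>) \<in> degree2_cocycles X"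
  by (auto simp: degree2_cocycles_def cocycles_scale)

lemma degree2_cocycles_zero: "(\<lambda>p \<sigma>. 0) \<in> degree2_cocycles X"
  by (auto simp: degree2_cocycles_def cocycles_zero)

lemma degree2_cocycles_sum:
  "(\<And>i. i \<in> I \<Longrightarrow> f i \<in> degree2_cocycles X) \<Longrightarrow> (\<lambda>p \<sigma>. \<Sum>i\<in>I. f i p \<sigma>) \<in> degree2_cocycles X"
  by (induction I rule: infinite_finite_induct) (auto intro: degree2_cocycles_zero degree2_cocycles_add)

lemma cohom_class_zero: "cohom_class X (\<lambda>p \<sigma>. 0) = \<zero>\<^bsub>cohomology_ring X\<^esub>"
  by (subst cohom_class_eq_zero_iff[OF cocycles_zero])
    (auto simp: coboundaries_def cochains_def coboundary_zero intro!: image_eqI[of _ _ "\<lambda>p \<sigma>. 0"])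

lemma cohom2_group_simps:
  "carrier (cohom2_group X) = cohom_class X ` degree2_cocycles X"
  "x \<otimes>\<^bsub>cohom2_group X\<^esub> y = x \<oplus>\<^bsub>cohomology_ring X\<^esub> y"
  "\<one>\<^bsub>cohom2_group X\<^esub> = \<zero>\<^bsub>cohomology_ring X\<^esub>"
  by (simp_all add: cohom2_group_def cohomology_def degree2_cocycles_def)

lemma comm_group_cohom2_group: "comm_group (cohom2_group X)"
proof -
  interpret ring "cohomology_ring X :: ('a, int) cohom ring" by (rule ring_cohomology_ring)
  have c: "x \<in> carrier (cohomology_ring X)" if "x \<in> carrier (cohom2_group X)" for x
    using that by (auto simp: cohom2_group_simps degree2_cocycles_cocycles cohom_class_closed)
  show ?thesis
  proof (rule comm_groupI, goal_cases)
    case (1 x y)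
    then show ?case
      by (force simp: cohom2_group_simps degree2_cocycles_cocycles degree2_cocycles_add
          simp flip: cohom_class_add)
  next
    case 2
    then show ?case
      using degree2_cocycles_zero cohom_class_zero by (force simp: cohom2_group_simps)
  next
    case (6 x)
    then obtain f where f: "f \<in> degree2_cocycles X" "x = cohom_class X f"
      by (auto simp: cohom2_group_simps)
    have g: "(\<lambda>p \<sigma>. - 1 * f p \<sigma>) \<in> degree2_cocycles X"
      using f(1) by (rule degree2_cocycles_scale)
    have "cohom_class X (\<lambda>p \<sigma>. - 1 * f p \<sigma>) \<oplus>\<^bsub>cohomology_ring X\<^esub> x = \<zero>\<^bsub>cohomology_ring X\<^esub>"
      using f g cohom_class_add[of "\<lambda>p \<sigma>. - 1 * f p \<sigma>" X f]
      by (simp add: degree2_cocycles_cocycles cohom_class_zero)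
    then show ?case
      using g by (auto simp: cohom2_group_simps intro!: bexI)
  qed (auto dest!: c simp: cohom2_group_simps(2,3) a_ac)
qed

lemma subgroup_torsion:
  fixes G :: "'g monoid" (structure)
  assumes "comm_group G"
  shows "subgroup (torsion G) G"
proof -
  interpret comm_group G by fact
  show ?thesis
  proof (rule subgroupI)
    show "torsion G \<subseteq> carrier G" by (auto simp: torsion_def)
    have "\<one> \<in> torsion G" by (auto simp: torsion_def intro!: exI[of _ 1])
    then show "torsion G \<noteq> {}" by blast
  next
    fix x assume "x \<in> torsion G"
    then show "inv x \<in> torsion G"
      by (auto simp: torsion_def nat_pow_inv)
  next
    fix x y assume "x \<in> torsion G" "y \<in> torsion G"
    then obtain k l :: nat where k: "x \<in> carrier G" "0 < k" "x [^] k = \<one>" and l: "y \<in> carrier G" "0 < l" "y [^] l = \<one>"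
      by (auto simp: torsion_def)
    have "x [^] (k * l) = \<one>"
      using k nat_pow_pow[of x k l] by simp
    moreover have "y [^] (k * l) = \<one>"
      using l nat_pow_pow[of y l k] by (simp add: mult.commute)
    ultimately show "x \<otimes> y \<in> torsion G"
      using k l by (auto simp: torsion_def nat_pow_distrib intro!: exI[of _ "k * l"])
  qed
qed

lemma comm_group_cohom2_lattice: "comm_group (cohom2_lattice X)"
  unfolding cohom2_lattice_def
  by (rule comm_group.abelian_FactGroup[OF comm_group_cohom2_group subgroup_torsion[OF comm_group_cohom2_group]])

lemma cohom_class_nat_pow:
  assumes "f \<in> degree2_cocycles X"
  shows "cohom_class X f [^]\<^bsub>cohom2_group X\<^esub> (k::nat) = cohom_class X (\<lambda>p \<sigma>. int k * f p \<sigma>)"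
proof (induction k)
  case 0
  then show ?case by (simp add: cohom2_group_simps cohom_class_zero)
next
  case (Suc k)
  have "(\<lambda>p \<sigma>. int (Suc k) * f p \<sigma>) = (\<lambda>p \<sigma>. int k * f p \<sigma> + f p \<sigma>)"
    by (simp add: algebra_simps)
  then show ?case
    using assms Suc by (simp add: cohom2_group_simps cohom_class_add degree2_cocycles_scale degree2_cocycles_cocycles)
qed

definition class_mod_torsion :: "'a topology \<Rightarrow> ('a, int) cochain \<Rightarrow> ('a, int) cohom set" where
  "class_mod_torsion X f = torsion (cohom2_group X) #>\<^bsub>cohom2_group X\<^esub> cohom_class X f"

lemma normal_torsion: "torsion (cohom2_group X) \<lhd> cohom2_group X"
  by (simp add: comm_group.normal_iff_subgroup comm_group_cohom2_group subgroup_torsion)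

lemma class_mod_torsion_closed:
  "f \<in> degree2_cocycles X \<Longrightarrow> class_mod_torsion X f \<in> carrier (cohom2_lattice X)"
  by (auto simp: class_mod_torsion_def cohom2_lattice_def FactGroup_def RCOSETS_def cohom2_group_simps)

lemma cohom2_lattice_cases:
  assumes "x \<in> carrier (cohom2_lattice X)"
  obtains f where "f \<in> degree2_cocycles X" "x = class_mod_torsion X f"
  using assms by (auto simp: class_mod_torsion_def cohom2_lattice_def FactGroup_def RCOSETS_def cohom2_group_simps)

lemma class_mod_torsion_add:
  assumes "f \<in> degree2_cocycles X" "g \<in> degree2_cocycles X"
  shows "class_mod_torsion X (\<lambda>p \<sigma>. f p \<sigma> + g p \<sigma>) = class_mod_torsion X f \<otimes>\<^bsub>cohom2_lattice X\<^esub> class_mod_torsion X g"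
proof -
  have "cohom_class X f \<in> carrier (cohom2_group X)" "cohom_class X g \<in> carrier (cohom2_group X)"
    using assms by (auto simp: cohom2_group_simps)
  with assms show ?thesis
    using hom_mult[OF normal.r_coset_hom_Mod[OF normal_torsion], of "cohom_class X f" X "cohom_class X g"]
    by (simp add: class_mod_torsion_def cohom2_lattice_def cohom_class_add degree2_cocycles_cocycles cohom2_group_simps(2))
qed

lemma class_mod_torsion_zero: "class_mod_torsion X (\<lambda>p \<sigma>. 0) = \<one>\<^bsub>cohom2_lattice X\<^esub>"
proof -
  interpret comm_group "cohom2_lattice X" by (rule comm_group_cohom2_lattice)
  have c: "class_mod_torsion X (\<lambda>p \<sigma>. 0) \<in> carrier (cohom2_lattice X)"
    by (simp add: class_mod_torsion_closed degree2_cocycles_zero)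
  have "class_mod_torsion X (\<lambda>p \<sigma>. 0) \<otimes>\<^bsub>cohom2_lattice X\<^esub> class_mod_torsion X (\<lambda>p \<sigma>. 0) = class_mod_torsion X (\<lambda>p \<sigma>. 0)"
    using class_mod_torsion_add[OF degree2_cocycles_zero degree2_cocycles_zero, of X] by simp
  with c show ?thesis by (metis r_cancel_one')
qed

lemma class_mod_torsion_uminus:
  assumes "f \<in> degree2_cocycles X"
  shows "inv\<^bsub>cohom2_lattice X\<^esub> (class_mod_torsion X f) = class_mod_torsion X (\<lambda>p \<sigma>. - f p \<sigma>)"
proof -
  interpret comm_group "cohom2_lattice X" by (rule comm_group_cohom2_lattice)
  have f: "(\<lambda>p \<sigma>. - f p \<sigma>) \<in> degree2_cocycles X"
    using degree2_cocycles_scale[OF assms, of "-1"] by simp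
  show ?thesis
    using class_mod_torsion_add[OF f assms] class_mod_torsion_zero[of X] assms f
    by (intro inv_equality) (auto simp: class_mod_torsion_closed)
qed

lemma class_mod_torsion_int_pow:
  assumes "f \<in> degree2_cocycles X"
  shows "class_mod_torsion X f [^]\<^bsub>cohom2_lattice X\<^esub> (k::int) = class_mod_torsion X (\<lambda>p \<sigma>. k * f p \<sigma>)"
proof -
  interpret comm_group "cohom2_lattice X" by (rule comm_group_cohom2_lattice)
  have nat: "class_mod_torsion X f [^]\<^bsub>cohom2_lattice X\<^esub> (n::nat) = class_mod_torsion X (\<lambda>p \<sigma>. int n * f p \<sigma>)" for n
  proof (induction n)
    case 0
    then show ?case by (simp add: class_mod_torsion_zero)
  next
    case (Suc n)
    have "(\<lambda>p \<sigma>. int (Suc n) * f p \<sigma>) = (\<lambda>p \<sigma>. int n * f p \<sigma> + f p \<sigma>)"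
      by (simp add: algebra_simps)
    then show ?case
      using assms Suc by (simp add: class_mod_torsion_add degree2_cocycles_scale)
  qed
  show ?thesis
  proof (cases k rule: int_cases2)
    case (nonneg n)
    then show ?thesis by (simp add: int_pow_int nat)
  next
    case (nonpos n)
    then show ?thesis
      using assms by (simp add: int_pow_neg int_pow_int nat class_mod_torsion_closed class_mod_torsion_uminus degree2_cocycles_scale)
  qed
qed

lemma int_comb_class_mod_torsion:
  assumes "\<And>i. i \<in> {1..b} \<Longrightarrow> f i \<in> degree2_cocycles X" "\<And>i. i \<in> {1..b} \<Longrightarrow> e i = class_mod_torsion X (f i)"
  shows "int_comb (cohom2_lattice X) b e k = class_mod_torsion X (\<lambda>p \<sigma>. \<Sum>i=1..b. k i * f i p \<sigma>)"
  using assms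
proof (induction b)
  case 0
  interpret comm_group "cohom2_lattice X" by (rule comm_group_cohom2_lattice)
  show ?case by (simp add: int_comb_def class_mod_torsion_zero)
next
  case (Suc b)
  interpret comm_group "cohom2_lattice X" by (rule comm_group_cohom2_lattice)
  have e: "e i [^]\<^bsub>cohom2_lattice X\<^esub> k i = class_mod_torsion X (\<lambda>p \<sigma>. k i * f i p \<sigma>)"
    and f: "(\<lambda>p \<sigma>. k i * f i p \<sigma>) \<in> degree2_cocycles X" if "i \<in> {1..Suc b}" for i
    using Suc.prems that by (auto simp: class_mod_torsion_int_pow degree2_cocycles_scale)
  have c: "e i [^]\<^bsub>cohom2_lattice X\<^esub> k i \<in> carrier (cohom2_lattice X)" if "i \<in> {1..Suc b}" for i
    unfolding e[OF that] using f[OF that] by (rule class_mod_torsion_closed)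
  have "int_comb (cohom2_lattice X) (Suc b) e k =
      e (Suc b) [^]\<^bsub>cohom2_lattice X\<^esub> k (Suc b) \<otimes>\<^bsub>cohom2_lattice X\<^esub> int_comb (cohom2_lattice X) b e k"
    unfolding int_comb_def using c
    by (subst atLeastAtMostSuc_conv, simp, subst finprod_insert) (auto simp: Pi_def)
  also have "int_comb (cohom2_lattice X) b e k = class_mod_torsion X (\<lambda>p \<sigma>. \<Sum>i=1..b. k i * f i p \<sigma>)"
    using Suc by simp
  also have "e (Suc b) [^]\<^bsub>cohom2_lattice X\<^esub> k (Suc b) \<otimes>\<^bsub>cohom2_lattice X\<^esub>
      class_mod_torsion X (\<lambda>p \<sigma>. \<Sum>i=1..b. k i * f i p \<sigma>) =
      class_mod_torsion X (\<lambda>p \<sigma>. k (Suc b) * f (Suc b) p \<sigma> + (\<Sum>i=1..b. k i * f i p \<sigma>))"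
  proof -
    have "(\<lambda>p \<sigma>. \<Sum>i=1..b. k i * f i p \<sigma>) \<in> degree2_cocycles X"
      by (rule degree2_cocycles_sum) (rule f, simp)
    moreover have "(\<lambda>p \<sigma>. k (Suc b) * f (Suc b) p \<sigma>) \<in> degree2_cocycles X"
      by (rule f) simp
    ultimately show ?thesis
      using e[of "Suc b"] class_mod_torsion_add[of "\<lambda>p \<sigma>. k (Suc b) * f (Suc b) p \<sigma>"] by simp
  qed
  also have "\<dots> = class_mod_torsion X (\<lambda>p \<sigma>. \<Sum>i=1..Suc b. k i * f i p \<sigma>)"
    by (simp add: add.commute)
  finally show ?case .
qed

text \<open>
  If \<open>k u = \<delta>h\<close> with \<open>k > 0\<close>, then \<open>u = \<delta>(h / k)\<close> over the rationals.
\<close>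
lemma rationalize_torsion:
  assumes "x \<in> torsion (cohom2_group X)"
  obtains u h where "u \<in> degree2_cocycles X" "x = cohom_class X u" "h \<in> cochains X"
    "(\<lambda>p \<sigma>. of_int (u p \<sigma>) :: rat) = coboundary X h"
proof -
  obtain u k where u: "u \<in> degree2_cocycles X" "x = cohom_class X u" and k: "0 < k"
    "x [^]\<^bsub>cohom2_group X\<^esub> (k::nat) = \<one>\<^bsub>cohom2_group X\<^esub>"
    using assms by (auto simp: torsion_def cohom2_group_simps)
  have "cohom_class X (\<lambda>p \<sigma>. int k * u p \<sigma>) = \<zero>\<^bsub>cohomology_ring X\<^esub>"
    using k u by (simp add: cohom_class_nat_pow cohom2_group_simps)
  then have "(\<lambda>p \<sigma>. int k * u p \<sigma>) \<in> coboundaries X"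
    using u by (subst (asm) cohom_class_eq_zero_iff) (auto simp: cocycles_scale degree2_cocycles_cocycles)
  then obtain h where h: "h \<in> cochains X" "(\<lambda>p \<sigma>. int k * u p \<sigma>) = coboundary X h"
    by (auto simp: coboundaries_def)
  have "of_int (u p \<sigma>) = 1 / of_nat k * (of_int (coboundary X h p \<sigma>) :: rat)" for p \<sigma>
    using k(1) by (simp flip: h(2))
  also have "\<dots> p \<sigma> = coboundary X (\<lambda>p \<sigma>. 1 / of_nat k * of_int (h p \<sigma>)) p \<sigma>" for p \<sigma>
    by (simp only: coboundary_scale coboundary_of_int)
  finally have "(\<lambda>p \<sigma>. of_int (u p \<sigma>) :: rat) = coboundary X (\<lambda>p \<sigma>. 1 / of_nat k * of_int (h p \<sigma>))"
    by (intro ext)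
  moreover have "(\<lambda>p \<sigma>. 1 / of_nat k * of_int (h p \<sigma>) :: rat) \<in> cochains X"
    using h(1) by (auto simp: cochains_def)
  ultimately show ?thesis
    using that u by blast
qed

text \<open>
  The chosen representative of a coset differs from the class of \<open>f\<close> by a torsion class, which
  disappears over the rationals. This is the independence of the index of the torsion part.
\<close>
lemma rationalize_rep_class_mod_torsion:
  assumes "f \<in> degree2_cocycles X"
  shows "rationalize X (rep (class_mod_torsion X f)) = cohom_class X (\<lambda>p \<sigma>. of_int (f p \<sigma>))"
proof -
  interpret comm_group "cohom2_group X" by (rule comm_group_cohom2_group)
  have c: "cohom_class X f \<in> carrier (cohom2_group X)"
    using assms by (simp add: cohom2_group_simps)
  have "cohom_class X f \<in> class_mod_torsion X f"
    unfolding class_mod_torsion_def using c rcos_self subgroup_torsion[OF comm_group_axioms] by blast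
  then have "rep (class_mod_torsion X f) \<in> class_mod_torsion X f"
    unfolding rep_def by (rule someI)
  then obtain x where x: "x \<in> torsion (cohom2_group X)"
    "rep (class_mod_torsion X f) = x \<otimes>\<^bsub>cohom2_group X\<^esub> cohom_class X f"
    by (auto simp: class_mod_torsion_def r_coset_def)
  obtain u h where u: "u \<in> degree2_cocycles X" "x = cohom_class X u" "h \<in> cochains X"
    "(\<lambda>p \<sigma>. of_int (u p \<sigma>) :: rat) = coboundary X h"
    using x(1) by (rule rationalize_torsion)
  have "rep (class_mod_torsion X f) = cohom_class X (\<lambda>p \<sigma>. u p \<sigma> + f p \<sigma>)"
    using x(2) u assms by (simp add: cohom2_group_simps(2) cohom_class_add degree2_cocycles_cocycles)
  then have "rationalize X (rep (class_mod_torsion X f)) = cohom_class X (\<lambda>p \<sigma>. of_int (u p \<sigma>) + of_int (f p \<sigma>))"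
    using u assms by (simp add: rationalize_class cocycles_add degree2_cocycles_cocycles)
  also have "\<dots> = cohom_class X (\<lambda>p \<sigma>. coboundary X h p \<sigma> + of_int (f p \<sigma>))"
    using fun_cong[OF fun_cong[OF u(4)]] by simp
  also have "\<dots> = cohom_class X (\<lambda>p \<sigma>. of_int (f p \<sigma>))"
    using u(3) assms by (intro cohom_class_absorb cocycles_of_int) (auto simp: degree2_cocycles_cocycles)
  finally show ?thesis .
qed

section \<open>The index map as a polynomial function\<close>

lemma poly_fun_cup:
  assumes "\<And>p \<sigma>. poly_fun b d (\<lambda>k. F k p \<sigma>)" "\<And>p \<sigma>. poly_fun b d' (\<lambda>k. G k p \<sigma>)"
  shows "poly_fun b (d + d') (\<lambda>k. cup X (F k) (G k) p \<sigma>)"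
  unfolding cup_def using assms
  by (cases "singular_simplex p X \<sigma>") (auto intro!: poly_fun_const poly_fun_sum poly_fun_mult)

text \<open>
  For a linear family \<open>C\<close>, each further cup product multiplies the values by one more linear factor.
\<close>
lemma poly_fun_cup_power:
  assumes "\<And>p \<sigma>. poly_fun b 1 (\<lambda>k. C k p \<sigma>)"
  shows "poly_fun b l (\<lambda>k. (C k [^]\<^bsub>cocycle_ring X\<^esub> l) p \<sigma>)"
proof (induction l arbitrary: p \<sigma>)
  case 0
  then show ?case by (simp add: poly_fun_const)
next
  case (Suc l)
  have "poly_fun b (l + 1) (\<lambda>k. cup X (C k [^]\<^bsub>cocycle_ring X\<^esub> l) (C k) p \<sigma>)"
    using Suc assms by (intro poly_fun_cup)
  then show ?case by simp
qed

text \<open>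
  The component of \<open>exp C\<close> of degree \<open>q\<close> is zero for odd \<open>q\<close>, and for \<open>q = 2 l\<close> it is polynomial of degree
  at most \<open>l\<close> in \<open>k\<close>. The evaluation on a cycle of dimension \<open>2 n\<close> involves only \<open>q \<le> 2 n\<close>.
\<close>
theorem poly_fun_index_map:
  fixes A :: "'a chart set"
  assumes f: "\<And>i. i \<in> {1..b} \<Longrightarrow> f i \<in> degree2_cocycles X"
  shows "poly_fun b n (\<lambda>k. index_map n X A J (class_mod_torsion X (\<lambda>p \<sigma>. \<Sum>i=1..b. k i * f i p \<sigma>)))"
proof -
  define C :: "(nat \<Rightarrow> int) \<Rightarrow> ('a, rat) cochain" where
    "C k = (\<lambda>p \<sigma>. \<Sum>i=1..b. of_int (k i) * of_int (f i p \<sigma>))" for k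
  define E where "E k = even_part (\<lambda>l. cup X (const_cochain X (1 / fact l)) (C k [^]\<^bsub>cocycle_ring X\<^esub> l))" for k
  let ?z = "rep (fundamental_class n X A J)"
  obtain t where t: "t \<in> cocycles X" "todd_class n (tangent_bundle n X A J) = cohom_class X t"
    using todd_class_cocycle[of "tangent_bundle n X A J" n] by (auto simp: tangent_bundle_def)
  have index: "index_map n X A J (class_mod_torsion X (\<lambda>p \<sigma>. \<Sum>i=1..b. k i * f i p \<sigma>)) =
      chain_pairing (cup X (E k) t (2 * n)) ?z" for k
  proof -
    have h: "(\<lambda>p \<sigma>. \<Sum>i=1..b. k i * f i p \<sigma>) \<in> degree2_cocycles X"
      using f by (intro degree2_cocycles_sum degree2_cocycles_scale)
    have r: "rationalize X (rep (class_mod_torsion X (\<lambda>p \<sigma>. \<Sum>i=1..b. k i * f i p \<sigma>))) = cohom_class X (C k)"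
      using rationalize_rep_class_mod_torsion[OF h] by (simp add: C_def)
    have C: "C k \<in> cocycles X"
      using cocycles_of_int[OF degree2_cocycles_cocycles[OF h], where 'b = rat] by (simp add: C_def)
    interpret ring "cocycle_ring X :: ('a, rat) cochain ring" by (rule ring_cocycle_ring)
    have "C k [^]\<^bsub>cocycle_ring X\<^esub> l \<in> cocycles X" for l :: nat
      using nat_pow_closed[of "C k" l] C by simp
    then have "E k \<in> cocycles X"
      unfolding E_def by (intro even_part_cocycle cup_cocycles const_cochain_cocycle)
    then have "cohom_exp X (cohom_class X (C k)) \<otimes>\<^bsub>cohomology_ring X\<^esub>
        todd_class n (tangent_bundle n X A J) = cohom_class X (cup X (E k) t)"
      using C t by (simp add: cohom_exp_class cohom_class_cup flip: E_def)
    then show ?thesis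
      unfolding index_map_def index_of_class_def r
      by (simp only: kronecker_class[OF rep_homology_cycle[OF fundamental_class_closed]])
  qed
  have C: "poly_fun b 1 (\<lambda>k. C k p \<sigma>)" for p \<sigma>
    unfolding C_def by (rule poly_fun_linear)
  have E: "poly_fun b n (\<lambda>k. E k q \<sigma>)" if "q \<le> 2 * n" for q \<sigma>
  proof -
    have "poly_fun b (0 + q div 2)
        (\<lambda>k. cup X (const_cochain X (1 / fact (q div 2))) (C k [^]\<^bsub>cocycle_ring X\<^esub> (q div 2)) q \<sigma>)"
      using C by (intro poly_fun_cup poly_fun_const poly_fun_cup_power)
    moreover have "q div 2 \<le> n" using that by simp
    ultimately show ?thesis
      by (cases "even q") (auto simp: E_def even_part_def intro: poly_fun_const poly_fun_mono)
  qed
  have "poly_fun b n (\<lambda>k. cup X (E k) t (2 * n) \<sigma>)" for \<sigma>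
  proof (cases "singular_simplex (2 * n) X \<sigma>")
    case True
    have "poly_fun b (n + 0) (\<lambda>k. \<Sum>i\<le>2 * n. E k i (front_face i \<sigma>) * t (2 * n - i) (back_face i (2 * n - i) \<sigma>))"
      by (intro poly_fun_sum poly_fun_mult E poly_fun_const) simp
    then show ?thesis using True by (simp add: cup_def)
  qed (simp add: cup_def poly_fun_const)
  then have "poly_fun b (0 + n) (\<lambda>k. chain_pairing (cup X (E k) t (2 * n)) ?z)"
    unfolding chain_pairing_def by (intro poly_fun_sum poly_fun_mult poly_fun_const)
  then show ?thesis unfolding index by simp
qed

theorem theorem2p4:
  fixes X :: "'a topology" and A :: "'a chart set" and J :: "'a tangent \<Rightarrow> 'a tangent"
    and n b\<^sub>2 :: nat and L' :: "('a, int) cohom set set"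
    and \<eta> \<tau> :: "nat \<Rightarrow> ('a, int) cohom set" and m :: "nat \<Rightarrow> int"
  defines "L \<equiv> cohom2_lattice X"
    and "c\<^sub>1 \<equiv> c1_lattice n X A J"
    and "H \<equiv> hilbert_polynomial n X A J b\<^sub>2 \<tau>"
  assumes "almost_complex_manifold n X A J" and "compact_space X" and "connected_space X"
    and "b\<^sub>2 = betti_number 2 X"
    and "Z_basis L b\<^sub>2 \<tau>"
    and "full_rank_sublattice L' L"
    and "Z_basis (L\<lparr>carrier := L'\<rparr>) b\<^sub>2 \<eta>"
    and "c\<^sub>1 \<in> L'"
    and "\<forall>i\<in>{1..b\<^sub>2}. 0 < m i"
    and "c\<^sub>1 = int_comb L b\<^sub>2 \<eta> m"
    and "index_map n X A J (inv\<^bsub>L\<^esub> c\<^sub>1) \<noteq> 0"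
    and "\<forall>k :: nat \<Rightarrow> int. (\<forall>i\<in>{1..b\<^sub>2}. 0 < k i \<and> k i \<le> m i) \<and>
           (\<Sum>i=1..b\<^sub>2. k i) < (\<Sum>i=1..b\<^sub>2. m i) \<longrightarrow>
           index_map n X A J (int_comb L b\<^sub>2 \<eta> (\<lambda>i. - k i)) = 0"
  shows "n \<ge> mpoly_degree H \<and> int (mpoly_degree H) \<ge> (\<Sum>i=1..b\<^sub>2. (m i - 1))"
proof -
  \<comment> \<open>The polynomial that gives the index in the basis \<open>\<tau>\<close> has degree at most \<open>n\<close>, and it is \<open>H\<close> by uniqueness.\<close>
  have "\<forall>j\<in>{1..b\<^sub>2}. \<exists>f. f \<in> degree2_cocycles X \<and> \<tau> j = class_mod_torsion X f"
    using \<open>Z_basis L b\<^sub>2 \<tau>\<close> cohom2_lattice_cases unfolding L_def Z_basis_def by metis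
  then obtain f where f: "\<And>j. j \<in> {1..b\<^sub>2} \<Longrightarrow> f j \<in> degree2_cocycles X"
    and \<tau>: "\<And>j. j \<in> {1..b\<^sub>2} \<Longrightarrow> \<tau> j = class_mod_torsion X (f j)"
    by metis
  define F where "F k = index_map n X A J (int_comb L b\<^sub>2 \<tau> k)" for k
  have \<tau>_comb: "int_comb L b\<^sub>2 \<tau> k = class_mod_torsion X (\<lambda>p \<sigma>. \<Sum>j=1..b\<^sub>2. k j * f j p \<sigma>)" for k
    unfolding L_def using f \<tau> by (rule int_comb_class_mod_torsion)
  have "poly_fun b\<^sub>2 n F"
    using poly_fun_index_map[OF f, where n = n and A = A and J = J] by (simp add: F_def[abs_def] \<tau>_comb)
  then obtain P where P: "mpoly_vars P \<subseteq> {1..b\<^sub>2}" "mpoly_degree P \<le> n" "\<And>k. F k = int_eval k P"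
    by (auto simp: poly_fun_def)
  have "H = P"
    unfolding H_def hilbert_polynomial_def
  proof (rule the_equality)
    fix Q :: mpoly_rat
    assume Q: "mpoly_vars Q \<subseteq> {1..b\<^sub>2} \<and> (\<forall>k :: nat \<Rightarrow> int. mpoly_eval (\<lambda>r. r) (\<lambda>i. of_int (k i)) Q =
      index_map n X A J (int_comb (cohom2_lattice X) b\<^sub>2 \<tau> k))"
    then show "Q = P"
      using P(1,3) by (intro mpoly_eq_if_int_eval_eq[of Q b\<^sub>2]) (auto simp: int_eval_def F_def L_def)
  qed (use P in \<open>auto simp: int_eval_def F_def L_def\<close>)
  then have F: "poly_fun b\<^sub>2 (mpoly_degree H) F"
    using P unfolding poly_fun_def by blast
  have "L' \<subseteq> carrier L"
    using \<open>full_rank_sublattice L' L\<close> by (simp add: full_rank_sublattice_def subgroup.subset)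
  then have "\<forall>i\<in>{1..b\<^sub>2}. \<exists>a. \<eta> i = int_comb L b\<^sub>2 \<tau> a"
    using \<open>Z_basis L b\<^sub>2 \<tau>\<close> \<open>Z_basis (L\<lparr>carrier := L'\<rparr>) b\<^sub>2 \<eta>\<close> by (auto simp: Z_basis_def)
  then obtain a where a: "\<And>i. i \<in> {1..b\<^sub>2} \<Longrightarrow> \<eta> i = int_comb L b\<^sub>2 \<tau> (a i)"
    by metis
  \<comment> \<open>cocycles of the \<open>\<eta> i\<close> built from those of the \<open>\<tau> j\<close>, so that the change of basis can be done on cocycles\<close>
  define g where "g i = (\<lambda>p \<sigma>. \<Sum>j=1..b\<^sub>2. a i j * f j p \<sigma>)" for i
  have g: "g i \<in> degree2_cocycles X" for i
    unfolding g_def using f by (intro degree2_cocycles_sum degree2_cocycles_scale)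
  have \<eta>_comb: "int_comb L b\<^sub>2 \<eta> k = class_mod_torsion X (\<lambda>p \<sigma>. \<Sum>i=1..b\<^sub>2. k i * g i p \<sigma>)" for k
    unfolding L_def using g a \<tau>_comb by (intro int_comb_class_mod_torsion) (auto simp: g_def)
  define G where "G k = F (\<lambda>j. \<Sum>i=1..b\<^sub>2. k i * a i j)" for k
  have G_eq: "G k = index_map n X A J (int_comb L b\<^sub>2 \<eta> k)" for k
  proof -
    have "(\<Sum>i=1..b\<^sub>2. k i * g i p \<sigma>) = (\<Sum>j=1..b\<^sub>2. (\<Sum>i=1..b\<^sub>2. k i * a i j) * f j p \<sigma>)" for p \<sigma>
      unfolding g_def sum_distrib_left sum_distrib_right by (subst sum.swap) (simp add: mult.assoc)
    then show ?thesis by (simp add: G_def F_def \<tau>_comb \<eta>_comb)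
  qed
  have "poly_fun b\<^sub>2 (mpoly_degree H) G"
    unfolding G_def using F
  proof (rule poly_fun_substitute)
    fix j
    show "poly_fun b\<^sub>2 1 (\<lambda>k. of_int (\<Sum>i=1..b\<^sub>2. k i * a i j))"
      using poly_fun_linear[of b\<^sub>2 "\<lambda>i. of_int (a i j)"] by simp
  qed
  moreover have "G (\<lambda>i. - m i) \<noteq> 0"
  proof -
    have "(\<lambda>p \<sigma>. \<Sum>i=1..b\<^sub>2. m i * g i p \<sigma>) \<in> degree2_cocycles X"
      using g by (intro degree2_cocycles_sum degree2_cocycles_scale)
    then have "inv\<^bsub>L\<^esub> c\<^sub>1 = int_comb L b\<^sub>2 \<eta> (\<lambda>i. - m i)"
      unfolding \<open>c\<^sub>1 = int_comb L b\<^sub>2 \<eta> m\<close> \<eta>_comb unfolding L_def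
      by (simp add: class_mod_torsion_uminus sum_negf)
    then show ?thesis
      using \<open>index_map n X A J (inv\<^bsub>L\<^esub> c\<^sub>1) \<noteq> 0\<close> by (simp add: G_eq)
  qed
  ultimately have "(\<Sum>i=1..b\<^sub>2. (m i - 1)) \<le> int (mpoly_degree H)"
    using assms(12,15) by (intro degree_lower_bound[of b\<^sub>2 _ G m]) (auto simp: G_eq)
  with P(2) \<open>H = P\<close> show ?thesis by simp
qed

end
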